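(* Let $F$ be a field of characteristic zero and let $UT_2$ be the algebra of $2\times2$ upper triangular matrices over $F$ with the canonical $\mathbb{Z}_2$-grading $UT_2^0=Fe_{11}\oplus Fe_{22}$, $UT_2^1=Fe_{12}$, regarded as a $\mathbb{Z}_2$-graded $W$-algebra for $W=UT_2$ acting on itself by left and right multiplication. Then $$\mathrm{Id}^{\mathbb{Z}_2,UT_2}(UT_2)=\langle [y_1,y_2],\ e_{22}y-ye_{22},\ ze_{22}-z,\ e_{22}z\rangle_{T_{\mathbb{Z}_2,UT_2}}$$ and, for all $n\ge 1$, $c_n^{\mathbb{Z}_2,UT_2}(UT_2)=2^{n-1}(n+2)+2$.
   Context: $e_{ij}$ are matrix units and $[a,b]=ab-ba$. Put $W=UT_2$ (with the canonical grading). Let $y_1,y_2,\dots$ be variables of degree $0$ and $z_1,z_2,\dots$ variables of degree $1$ (write $y,z$ for one such variable), and let $\{w_i\}=\{1=e_{11}+e_{22},e_{22},e_{12}\}$. The free $\mathbb{Z}_2$-graded $W$-algebra $W\langle Y,Z\rangle$ has vector space basis the monomials $w_{i_0}u_1w_{i_1}\cdots w_{i_{n-1}}u_nw_{i_n}$, $n\ge1$, each $u_j$ a variable; the product is juxtaposition followed by multiplication in $W$, $W$ acts by multiplication at the two ends, a variable $x$ is identified with $1x1$, and the degree of a monomial is the sum of the degrees of its variables and of the $w$'s. $\mathrm{Id}^{\mathbb{Z}_2,W}(A)$ is the set of elements vanishing under all substitutions of the $y$'s by elements of $A^0$ and the $z$'s by elements of $A^1$. A $T_{\mathbb{Z}_2,W}$-ideal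 is a two-sided ideal, closed under the left and right $W$-action, invariant under all graded $W$-algebra endomorphisms of $W\langle Y,Z\rangle$; $\langle S\rangle_{T_{\mathbb{Z}_2,W}}$ is the smallest one containing $S$. $P_n^{\mathbb{Z}_2,W}$ is the span of all monomials $w_{i_0}u_{\sigma(1)}w_{i_1}\cdots u_{\sigma(n)}w_{i_n}$ with $\sigma\in S_n$ and each $u_i\in\{y_i,z_i\}$, and $c_n^{\mathbb{Z}_2,W}(A)=\dim_F P_n^{\mathbb{Z}_2,W}/(P_n^{\mathbb{Z}_2,W}\cap\mathrm{Id}^{\mathbb{Z}_2,W}(A))$. *)

theory Defs
  imports
    "HOL-Analysis.Cartesian_Space"
    "HOL-Library.Numeral_Type"
    "HOL-Library.Poly_Mapping"
    "HOL-Combinatorics.Permutations"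
    "Jordan_Normal_Form.Missing_VectorSpace"
begin

text \<open>
  Matrices are of type \<open>'f^2^2\<close>, with rows and columns indexed by \<open>1, 2 :: 2\<close>. The same type \<open>2\<close>,
  which is the ring of integers modulo 2, also serves as the grading group.
\<close>

definition e11 :: "'f::field^2^2" where
  "e11 = (\<chi> i j. if i = 1 \<and> j = 1 then 1 else 0)"

definition e12 :: "'f::field^2^2" where
  "e12 = (\<chi> i j. if i = 1 \<and> j = 2 then 1 else 0)"

definition e22 :: "'f::field^2^2" where
  "e22 = (\<chi> i j. if i = 2 \<and> j = 2 then 1 else 0)"

definition smat :: "'f::field \<Rightarrow> 'f^2^2 \<Rightarrow> 'f^2^2" where
  "smat c A = (\<chi> i j. c * A $ i $ j)"

definition UT2 :: "('f::field^2^2) set" where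
  "UT2 = {A. A $ 2 $ 1 = 0}"

definition UT2_component :: "2 \<Rightarrow> ('f::field^2^2) set" where
  "UT2_component d = (if d = 0 then {smat a e11 + smat b e22 | a b. True} else {smat c e12 | c. True})"


text \<open>The basis \<open>1, e22, e12\<close> of \<open>W = UT2\<close>.\<close>

datatype wbasis = W_one | W_e22 | W_e12

fun wmat :: "wbasis \<Rightarrow> 'f::field^2^2" where
  "wmat W_one = e11 + e22"
| "wmat W_e22 = e22"
| "wmat W_e12 = e12"

text \<open>
  Coordinates with respect to this basis: if \<open>A \<in> UT2\<close> then
  \<open>A = A11 (e11 + e22) + (A22 - A11) e22 + A12 e12\<close>.
\<close>

fun wcoord :: "'f::field^2^2 \<Rightarrow> wbasis \<Rightarrow> 'f" where
  "wcoord A W_one = A $ 1 $ 1"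
| "wcoord A W_e22 = A $ 2 $ 2 - A $ 1 $ 1"
| "wcoord A W_e12 = A $ 1 $ 2"

lemma wcoord_expand:
  assumes "A \<in> UT2"
  shows "A = (\<Sum>k\<in>{W_one, W_e22, W_e12}. smat (wcoord A k) (wmat k))"
  using assms
  by (auto simp: UT2_def vec_eq_iff forall_2 smat_def e11_def e22_def e12_def)

fun wdeg :: "wbasis \<Rightarrow> 2" where
  "wdeg W_one = 0"
| "wdeg W_e22 = 0"
| "wdeg W_e12 = 1"


text \<open>The variables \<open>Y i\<close> and \<open>Z i\<close> stand for \<open>y\<^bsub>i+1\<^esub>\<close> and \<open>z\<^bsub>i+1\<^esub>\<close>.\<close>

datatype var = Y nat | Z nat

fun vdeg :: "var \<Rightarrow> 2" where
  "vdeg (Y i) = 0"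
| "vdeg (Z i) = 1"

text \<open>
  \<open>Mon w0 u1 [(w1, u2), \<dots>, (w', un)] wn\<close> is the monomial \<open>w0 u1 w1 u2 \<dots> w' un wn\<close>; this shape
  enforces \<open>n \<ge> 1\<close>.
\<close>

datatype monom = Mon wbasis var "(wbasis \<times> var) list" wbasis

fun mdeg :: "monom \<Rightarrow> 2" where
  "mdeg (Mon a u s b) = wdeg a + vdeg u + (\<Sum>(k, v)\<leftarrow>s. wdeg k + vdeg v) + wdeg b"

type_synonym 'f free_walg = "monom \<Rightarrow>\<^sub>0 'f"

definition fscale :: "'f::field \<Rightarrow> 'f free_walg \<Rightarrow> 'f free_walg" where
  "fscale c f = Poly_Mapping.map ((*) c) f"

lemma lookup_fscale: "Poly_Mapping.lookup (fscale c f) m = c * Poly_Mapping.lookup f m"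
  unfolding fscale_def by transfer (simp add: when_def)

global_interpretation free: vector_space "fscale :: 'f::field \<Rightarrow> 'f free_walg \<Rightarrow> 'f free_walg"
  by unfold_locales
     (auto intro!: poly_mapping_eqI simp: lookup_fscale lookup_add algebra_simps)

definition fmono :: "monom \<Rightarrow> 'f::field free_walg" where
  "fmono m = Poly_Mapping.single m 1"

definition lin_ext :: "(monom \<Rightarrow> 'f::field free_walg) \<Rightarrow> 'f free_walg \<Rightarrow> 'f free_walg" where
  "lin_ext g f = (\<Sum>m\<in>Poly_Mapping.keys f. fscale (Poly_Mapping.lookup f m) (g m))"

fun mon_mult :: "monom \<Rightarrow> monom \<Rightarrow> 'f::field free_walg" where
  "mon_mult (Mon a u s b) (Mon c v t d) =
     (\<Sum>k\<in>{W_one, W_e22, W_e12}.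
        fscale (wcoord (wmat b ** wmat c) k) (fmono (Mon a u (s @ (k, v) # t) d)))"

fun mon_lact :: "'f::field^2^2 \<Rightarrow> monom \<Rightarrow> 'f free_walg" where
  "mon_lact A (Mon a u s b) =
     (\<Sum>k\<in>{W_one, W_e22, W_e12}. fscale (wcoord (A ** wmat a) k) (fmono (Mon k u s b)))"

fun mon_ract :: "monom \<Rightarrow> 'f::field^2^2 \<Rightarrow> 'f free_walg" where
  "mon_ract (Mon a u s b) A =
     (\<Sum>k\<in>{W_one, W_e22, W_e12}. fscale (wcoord (wmat b ** A) k) (fmono (Mon a u s k)))"

definition fmult :: "'f::field free_walg \<Rightarrow> 'f free_walg \<Rightarrow> 'f free_walg" where
  "fmult f g = lin_ext (\<lambda>m. lin_ext (mon_mult m) g) f"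

definition lact :: "'f::field^2^2 \<Rightarrow> 'f free_walg \<Rightarrow> 'f free_walg" where
  "lact A f = lin_ext (mon_lact A) f"

definition ract :: "'f::field free_walg \<Rightarrow> 'f^2^2 \<Rightarrow> 'f free_walg" where
  "ract f A = lin_ext (\<lambda>m. mon_ract m A) f"

definition fvar :: "var \<Rightarrow> 'f::field free_walg" where
  "fvar u = fmono (Mon W_one u [] W_one)"

definition fcomm :: "'f::field free_walg \<Rightarrow> 'f free_walg \<Rightarrow> 'f free_walg" where
  "fcomm f g = fmult f g - fmult g f"

definition free_component :: "2 \<Rightarrow> 'f::field free_walg set" where
  "free_component d = free.span (fmono ` {m. mdeg m = d})"


definition graded_W_endo :: "('f::field free_walg \<Rightarrow> 'f free_walg) \<Rightarrow> bool" where
  "graded_W_endo \<phi> \<longleftrightarrow>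
     (\<forall>f g. \<phi> (f + g) = \<phi> f + \<phi> g) \<and>
     (\<forall>c f. \<phi> (fscale c f) = fscale c (\<phi> f)) \<and>
     (\<forall>f g. \<phi> (fmult f g) = fmult (\<phi> f) (\<phi> g)) \<and>
     (\<forall>A\<in>UT2. \<forall>f. \<phi> (lact A f) = lact A (\<phi> f) \<and> \<phi> (ract f A) = ract (\<phi> f) A) \<and>
     (\<forall>d. \<phi> ` free_component d \<subseteq> free_component d)"

definition TW_ideal :: "'f::field free_walg set \<Rightarrow> bool" where
  "TW_ideal I \<longleftrightarrow>
     free.subspace I \<and>
     (\<forall>f\<in>I. \<forall>g. fmult f g \<in> I \<and> fmult g f \<in> I) \<and>
     (\<forall>f\<in>I. \<forall>A\<in>UT2. lact A f \<in> I \<and> ract f A \<in> I) \<and>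
     (\<forall>\<phi>. graded_W_endo \<phi> \<longrightarrow> \<phi> ` I \<subseteq> I)"

definition TW_ideal_gen :: "'f::field free_walg set \<Rightarrow> 'f free_walg set" where
  "TW_ideal_gen S = \<Inter>{I. TW_ideal I \<and> S \<subseteq> I}"


fun mon_eval :: "(var \<Rightarrow> 'f::field^2^2) \<Rightarrow> monom \<Rightarrow> 'f^2^2" where
  "mon_eval \<rho> (Mon a u s b) = foldl (\<lambda>P (k, v). P ** wmat k ** \<rho> v) (wmat a ** \<rho> u) s ** wmat b"

definition eval_at :: "(var \<Rightarrow> 'f::field^2^2) \<Rightarrow> 'f free_walg \<Rightarrow> 'f^2^2" where
  "eval_at \<rho> f = (\<Sum>m\<in>Poly_Mapping.keys f. smat (Poly_Mapping.lookup f m) (mon_eval \<rho> m))"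

definition Id_UT2 :: "'f::field free_walg set" where
  "Id_UT2 = {f. \<forall>\<rho>. (\<forall>u. \<rho> u \<in> UT2_component (vdeg u)) \<longrightarrow> eval_at \<rho> f = 0}"


definition multilinear_monoms :: "nat \<Rightarrow> monom set" where
  "multilinear_monoms n =
     {Mon a (u (\<sigma> 0)) (map (\<lambda>j. (w j, u (\<sigma> j))) [1..<n]) b | a b w u \<sigma>.
        \<sigma> permutes {..<n} \<and> (\<forall>i<n. u i \<in> {Y i, Z i})}"

definition multilinear_space :: "nat \<Rightarrow> 'f::field free_walg set" where
  "multilinear_space n = free.span (fmono ` multilinear_monoms n)"

definition scalar_ring :: "'f::field ring" where
  "scalar_ring = \<lparr>carrier = UNIV, mult = (*), one = 1, zero = 0, add = (+)\<rparr>"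

text \<open>
  The vector space \<open>V / U\<close> of cosets \<open>v + U\<close>, for subspaces \<open>U \<subseteq> V\<close>. The ring multiplication and unit
  required by the record type of modules are irrelevant.
\<close>

definition quotient_space ::
    "('f::field \<Rightarrow> 'v::ab_group_add \<Rightarrow> 'v) \<Rightarrow> 'v set \<Rightarrow> 'v set \<Rightarrow> ('f, 'v set) module" where
  "quotient_space sc V U =
     \<lparr>carrier = (\<lambda>v. {v + x | x. x \<in> U}) ` V, mult = undefined, one = undefined,
      zero = U, add = (\<lambda>A B. {a + b | a b. a \<in> A \<and> b \<in> B}),
      smult = (\<lambda>c A. {sc c a + x | a x. a \<in> A \<and> x \<in> U})\<rparr>"

lemma vectorspace_quotient_space:
  assumes "vector_space sc" and "Modules.module.subspace sc V" and "Modules.module.subspace sc U" and UV: "U \<subseteq> V"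
  shows "vectorspace scalar_ring (quotient_space sc V U)"
proof -
  interpret vector_space sc by fact
  note V = subspace_0[OF assms(2)] subspace_add[OF assms(2)] subspace_scale[OF assms(2)] subspace_neg[OF assms(2)]
  note U = subspace_0[OF assms(3)] subspace_add[OF assms(3)] subspace_scale[OF assms(3)] subspace_neg[OF assms(3)] subspace_diff[OF assms(3)]
  define co where "co v = {v + x | x. x \<in> U}" for v
  have mem: "y \<in> co v \<longleftrightarrow> y - v \<in> U" for y v
    by (auto simp: co_def intro!: exI[of _ "y - v"])
  have co0: "co 0 = U" by (simp add: co_def)
  have add: "{a + b | a b. a \<in> co v \<and> b \<in> co w} = co (v + w)" for v w
  proof (intro Set.set_eqI iffI)
    fix y assume "y \<in> {a + b | a b. a \<in> co v \<and> b \<in> co w}"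
    then obtain a b where "y = a + b" "a - v \<in> U" "b - w \<in> U" by (auto simp: mem)
    with U(2)[of "a - v" "b - w"] show "y \<in> co (v + w)" by (simp add: mem algebra_simps)
  next
    fix y assume "y \<in> co (v + w)"
    then have "y = (y - w) + w" "y - w \<in> co v" "w \<in> co w" using U(1) by (simp_all add: mem algebra_simps)
    then show "y \<in> {a + b | a b. a \<in> co v \<and> b \<in> co w}" by blast
  qed
  have smult: "{sc c a + x | a x. a \<in> co v \<and> x \<in> U} = co (sc c v)" for c v
  proof (intro Set.set_eqI iffI)
    fix y assume "y \<in> {sc c a + x | a x. a \<in> co v \<and> x \<in> U}"
    then obtain a x where "y = sc c a + x" "a - v \<in> U" "x \<in> U" by (auto simp: mem)
    with U(2)[OF U(3)[of "a - v" c], of x] show "y \<in> co (sc c v)" by (simp add: mem algebra_simps)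
  next
    fix y assume "y \<in> co (sc c v)"
    then have "y = sc c v + (y - sc c v)" "v \<in> co v" "y - sc c v \<in> U" using U(1) by (simp_all add: mem)
    then show "y \<in> {sc c a + x | a x. a \<in> co v \<and> x \<in> U}" by blast
  qed
  let ?Q = "quotient_space sc V U" and ?K = "scalar_ring :: 'a ring"
  have carr: "carrier ?Q = co ` V" and zero: "\<zero>\<^bsub>?Q\<^esub> = co 0"
    and add': "co v \<oplus>\<^bsub>?Q\<^esub> co w = co (v + w)" and smult': "c \<odot>\<^bsub>?Q\<^esub> co v = co (sc c v)" for v w c
    using co0 add smult by (simp_all add: quotient_space_def co_def)
  have K: "Ring.field ?K"
  proof (rule cring.cring_fieldI2)
    show "cring ?K"
      by (rule cringI)
         (auto simp: scalar_ring_def algebra_simps intro!: abelian_groupI comm_monoidI exI[of _ "- x" for x])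
  qed (auto simp: scalar_ring_def intro!: exI right_inverse)
  have "abelian_group ?Q"
  proof (rule abelian_groupI)
    fix X assume "X \<in> carrier ?Q"
    then obtain v where "X = co v" "v \<in> V" by (auto simp: carr)
    then show "\<exists>Y\<in>carrier ?Q. Y \<oplus>\<^bsub>?Q\<^esub> X = \<zero>\<^bsub>?Q\<^esub>"
      by (auto simp: carr zero add' intro!: bexI[of _ "- v"] V)
  qed (auto simp: carr zero add' algebra_simps intro!: V)
  then have "Module.module ?K ?Q"
    by (intro module.intro module_axioms.intro fieldE(1) K cring.axioms)
       (auto simp: carr add' smult' scalar_ring_def algebra_simps intro!: V imageI)
  then show ?thesis using K by (simp add: vectorspace_def)
qed

definition codimension :: "'f::field free_walg set \<Rightarrow> nat \<Rightarrow> nat" where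
  "codimension I n =
     vectorspace.dim scalar_ring
       (quotient_space fscale (multilinear_space n) (multilinear_space n \<inter> I))"

end

theory Submission
  imports Defs
begin

text \<open>
  Modulo the four relations every monomial is zero or equal to one of
  \<open>y\<^sup>M\<close>, \<open>y\<^sup>M e22\<close>, \<open>y\<^sup>M e12 y\<^sup>N\<close>, \<open>y\<^sup>M z\<^sub>k y\<^sup>N\<close>, where \<open>M\<close> and \<open>N\<close> are multisets of
  indices. Indeed the \<open>y\<close> commute with each other and with \<open>e22\<close>, so \<open>e22\<close> can be moved to the
  right until it reaches the end of the word or kills a following \<open>e12\<close> or \<open>z\<close>; moved to
  the left it is absorbed by a preceding \<open>e12\<close> or \<open>z\<close>. Hence two factors among the \<open>e12\<close> and \<open>z\<close>
  always give zero. The normal form of a monomial is computed by an automaton, \<open>nf\<close>, and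
  \<open>fmono_canon\<close> shows that the relations justify it.

  No further identities exist. Under the substitution of \<open>a\<^sub>i e11 + b\<^sub>i e22\<close> for \<open>y\<^sub>i\<close> and
  \<open>c\<^sub>k e12\<close> for \<open>z\<^sub>k\<close> the four kinds of normal forms have as entries \<open>a\<^sup>M\<close> and \<open>b\<^sup>M\<close> in the
  positions \<open>(1, 1)\<close> and \<open>(2, 2)\<close>, then \<open>b\<^sup>M\<close> in \<open>(2, 2)\<close>, then \<open>a\<^sup>M b\<^sup>N\<close> and \<open>a\<^sup>M c\<^sub>k b\<^sup>N\<close> in
  \<open>(1, 2)\<close>. In characteristic zero distinct monomials are linearly independent functions
  (\<open>monomial_functions_independent\<close>), so a linear combination of normal forms that vanishes under all
  substitutions is trivial (\<open>nform_val_independent\<close>). Therefore an element of the free algebra is an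
  identity exactly when, for each nonzero normal form, the coefficients of its monomials with that
  normal form add up to zero (\<open>mem_Id_UT2_iff\<close>), and all such elements lie in the ideal generated by
  the relations (\<open>mem_ideal\<close>).

  The same criterion shows that the normal forms of multilinear monomials of degree \<open>n\<close> are a basis
  of the multilinear space modulo identities. Here each index below \<open>n\<close> occurs exactly once, which
  leaves 2 forms without \<open>e12\<close> and \<open>z\<close>, \<open>2\<^sup>n\<close> forms with \<open>e12\<close> and \<open>n\<close> times \<open>2\<close> to the \<open>n - 1\<close>
  forms with one \<open>z\<close>.
\<close>


section \<open>Linear maps out of the free algebra\<close>

lemma vector_space_smat: "vector_space (smat :: 'f::field \<Rightarrow> 'f^2^2 \<Rightarrow> 'f^2^2)"
  by unfold_locales (auto simp: vec_eq_iff smat_def algebra_simps)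

lemma sum_keys_add:
  fixes f g :: "'f::field free_walg"
  assumes "vector_space sc"
  shows "(\<Sum>m\<in>Poly_Mapping.keys (f + g). sc (Poly_Mapping.lookup (f + g) m) (h m)) =
    (\<Sum>m\<in>Poly_Mapping.keys f. sc (Poly_Mapping.lookup f m) (h m)) +
    (\<Sum>m\<in>Poly_Mapping.keys g. sc (Poly_Mapping.lookup g m) (h m))"
proof -
  interpret vector_space sc by fact
  let ?K = "Poly_Mapping.keys f \<union> Poly_Mapping.keys g"
  have *: "(\<Sum>m\<in>Poly_Mapping.keys e. sc (Poly_Mapping.lookup e m) (h m)) =
      (\<Sum>m\<in>?K. sc (Poly_Mapping.lookup e m) (h m))" if "Poly_Mapping.keys e \<subseteq> ?K" for e
    using that by (intro sum.mono_neutral_left) (auto simp: in_keys_iff)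
  show ?thesis
    by (subst *[of "f + g", OF keys_add], subst *[of f], simp, subst *[of g], simp)
       (simp add: lookup_add scale_left_distrib sum.distrib)
qed

lemma sum_keys_scale:
  fixes f :: "'f::field free_walg"
  assumes "vector_space sc"
  shows "(\<Sum>m\<in>Poly_Mapping.keys (fscale c f). sc (Poly_Mapping.lookup (fscale c f) m) (h m)) =
    sc c (\<Sum>m\<in>Poly_Mapping.keys f. sc (Poly_Mapping.lookup f m) (h m))"
proof -
  interpret vector_space sc by fact
  have "Poly_Mapping.keys (fscale c f) \<subseteq> Poly_Mapping.keys f"
    by (auto simp: in_keys_iff lookup_fscale)
  then have "(\<Sum>m\<in>Poly_Mapping.keys (fscale c f). sc (Poly_Mapping.lookup (fscale c f) m) (h m)) =
      (\<Sum>m\<in>Poly_Mapping.keys f. sc (Poly_Mapping.lookup (fscale c f) m) (h m))"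
    by (intro sum.mono_neutral_left) (auto simp: in_keys_iff)
  then show ?thesis by (simp add: lookup_fscale scale_sum_right)
qed

lemma sum_keys_fmono:
  assumes "vector_space sc"
  shows "(\<Sum>m\<in>Poly_Mapping.keys (fmono n :: 'f::field free_walg).
      sc (Poly_Mapping.lookup (fmono n :: 'f free_walg) m) (h m)) = h n"
proof -
  interpret vector_space sc by fact
  show ?thesis by (simp add: fmono_def)
qed

lemma free_expand: "(f :: 'f::field free_walg) =
    (\<Sum>m\<in>Poly_Mapping.keys f. fscale (Poly_Mapping.lookup f m) (fmono m))"
proof (rule poly_mapping_eqI)
  fix k
  have "Poly_Mapping.lookup (\<Sum>m\<in>Poly_Mapping.keys f. fscale (Poly_Mapping.lookup f m) (fmono m)) k =
      (\<Sum>m\<in>Poly_Mapping.keys f. if m = k then Poly_Mapping.lookup f k else 0)"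
    unfolding lookup_sum
    by (rule sum.cong) (auto simp: lookup_fscale fmono_def lookup_single when_def)
  also have "\<dots> = Poly_Mapping.lookup f k"
    by (auto simp: in_keys_iff)
  finally show "Poly_Mapping.lookup f k =
      Poly_Mapping.lookup (\<Sum>m\<in>Poly_Mapping.keys f. fscale (Poly_Mapping.lookup f m) (fmono m)) k" ..
qed

text \<open>
  An identity between linear maps need only be checked on monomials: in the proofs below the cases
  other than \<open>mono\<close> are discharged by linearity.
\<close>

lemma free_induct [case_names zero mono scale add]:
  fixes f :: "'f::field free_walg"
  assumes "P 0" and "\<And>m. P (fmono m)" and "\<And>c f. P f \<Longrightarrow> P (fscale c f)"
    and "\<And>f g. P f \<Longrightarrow> P g \<Longrightarrow> P (f + g)"
  shows "P f"
proof -
  have "P (\<Sum>m\<in>A. fscale (c m) (fmono m))" if "finite A" for A and c :: "monom \<Rightarrow> 'f"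
    using that by induction (auto intro: assms)
  then show ?thesis by (subst free_expand) simp
qed

lemma lin_ext_add: "lin_ext h (f + g) = lin_ext h f + lin_ext h g"
  unfolding lin_ext_def by (rule sum_keys_add) unfold_locales

lemma lin_ext_scale: "lin_ext h (fscale c f) = fscale c (lin_ext h f)"
  unfolding lin_ext_def by (rule sum_keys_scale) unfold_locales

lemma lin_ext_fmono [simp]: "lin_ext h (fmono m) = h m"
  unfolding lin_ext_def by (rule sum_keys_fmono) unfold_locales

lemma lin_ext_zero [simp]: "lin_ext h 0 = 0"
  by (simp add: lin_ext_def)

lemma lin_ext_plus_fun: "lin_ext (\<lambda>m. h m + h' m) f = lin_ext h f + lin_ext h' f"
  by (simp add: lin_ext_def free.scale_right_distrib sum.distrib)

lemma lin_ext_scale_fun: "lin_ext (\<lambda>m. fscale c (h m)) f = fscale c (lin_ext h f)"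
  by (simp add: lin_ext_def free.scale_sum_right mult.commute)

lemma eval_add: "eval_at \<rho> (f + g) = eval_at \<rho> f + eval_at \<rho> g"
  unfolding eval_at_def by (rule sum_keys_add[OF vector_space_smat])

lemma eval_scale: "eval_at \<rho> (fscale c f) = smat c (eval_at \<rho> f)"
  unfolding eval_at_def by (rule sum_keys_scale[OF vector_space_smat])

lemma eval_fmono [simp]: "eval_at \<rho> (fmono m) = mon_eval \<rho> m"
  unfolding eval_at_def by (rule sum_keys_fmono[OF vector_space_smat])

lemma eval_zero [simp]: "eval_at \<rho> 0 = 0"
  by (simp add: eval_at_def)

lemma eval_minus: "eval_at \<rho> (f - g) = eval_at \<rho> f - eval_at \<rho> g"
  using eval_add[of \<rho> "f - g" g] by (simp add: algebra_simps)

lemma fmult_add_left: "fmult (f + g) h = fmult f h + fmult g h"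
  by (simp add: fmult_def lin_ext_add)

lemma fmult_add_right: "fmult h (f + g) = fmult h f + fmult h g"
  by (simp add: fmult_def lin_ext_add lin_ext_plus_fun)

lemma fmult_scale_left: "fmult (fscale c f) h = fscale c (fmult f h)"
  by (simp add: fmult_def lin_ext_scale)

lemma fmult_scale_right: "fmult h (fscale c f) = fscale c (fmult h f)"
  by (simp add: fmult_def lin_ext_scale lin_ext_scale_fun)

lemma fmult_zero_left [simp]: "fmult 0 f = 0"
  by (simp add: fmult_def)

lemma fmult_zero_right [simp]: "fmult f 0 = 0"
  using fmult_scale_right[of f 0 0] by simp

lemma fmult_fmono: "fmult (fmono m) (fmono n) = mon_mult m n"
  by (simp add: fmult_def)

lemma lact_add: "lact A (f + g) = lact A f + lact A g"
  by (simp add: lact_def lin_ext_add)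

lemma lact_scale: "lact A (fscale c f) = fscale c (lact A f)"
  by (simp add: lact_def lin_ext_scale)

lemma lact_zero [simp]: "lact A 0 = 0"
  by (simp add: lact_def)

lemma lact_fmono: "lact A (fmono m) = mon_lact A m"
  by (simp add: lact_def)

lemma ract_add: "ract (f + g) A = ract f A + ract g A"
  by (simp add: ract_def lin_ext_add)

lemma ract_scale: "ract (fscale c f) A = fscale c (ract f A)"
  by (simp add: ract_def lin_ext_scale)

lemma ract_zero [simp]: "ract 0 A = 0"
  by (simp add: ract_def)

lemma ract_fmono: "ract (fmono m) A = mon_ract m A"
  by (simp add: ract_def)

lemma fmult_minus_left: "fmult (f - g) h = fmult f h - fmult g h"
  using fmult_add_left[of "f - g" g h] by (simp add: algebra_simps)

lemma fmult_minus_right: "fmult h (f - g) = fmult h f - fmult h g"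
  using fmult_add_right[of h "f - g" g] by (simp add: algebra_simps)

lemma lact_minus: "lact A (f - g) = lact A f - lact A g"
  using lact_add[of A "f - g" g] by (simp add: algebra_simps)

lemma ract_minus: "ract (f - g) A = ract f A - ract g A"
  using ract_add[of "f - g" g A] by (simp add: algebra_simps)


section \<open>The coefficient algebra and the bimodule laws\<close>

lemma mat2_mult: "(A ** B) $ i $ j = A $ i $ 1 * B $ 1 $ j + A $ i $ 2 * B $ 2 $ j"
  for A B :: "'f::field^2^2"
  by (simp add: matrix_matrix_mult_def sum_2)

lemma UT2_mult: "A \<in> UT2 \<Longrightarrow> B \<in> UT2 \<Longrightarrow> A ** B \<in> UT2"
  by (simp add: UT2_def mat2_mult)

lemma UT2_mat1: "mat 1 \<in> UT2"
  by (simp add: UT2_def mat_def)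

lemma wmat_one: "wmat W_one = mat 1"
  by (simp add: vec_eq_iff forall_2 e11_def e22_def mat_def)

lemma wmat_UT2 [simp]: "wmat k \<in> UT2"
  by (cases k) (auto simp: UT2_def e11_def e22_def e12_def)

lemma e22_UT2 [simp]: "e22 \<in> UT2" and e12_UT2 [simp]: "e12 \<in> UT2"
  by (auto simp: UT2_def e22_def e12_def)

lemma e22_e22: "e22 ** e22 = e22" and e22_e12: "e22 ** e12 = 0"
  and e12_e22: "e12 ** e22 = e12" and e12_e12: "e12 ** e12 = 0"
  by (auto simp: vec_eq_iff forall_2 mat2_mult e22_def e12_def)

lemma wcoord_wmat: "wcoord (wmat k) l = (if k = l then 1 else 0)"
  by (cases k; cases l) (auto simp: e11_def e22_def e12_def)

text \<open>
  Products and actions on the free algebra all arise from placing a matrix \<open>X\<close> at one slot of a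
  monomial and expanding it in the basis of \<open>W\<close>; \<open>wsum G X\<close> is this expansion when \<open>G k\<close> is the
  monomial with the basis element \<open>k\<close> at that slot.
\<close>

definition wsum :: "(wbasis \<Rightarrow> 'f::field free_walg) \<Rightarrow> 'f^2^2 \<Rightarrow> 'f free_walg" where
  "wsum G X = (\<Sum>k\<in>{W_one, W_e22, W_e12}. fscale (wcoord X k) (G k))"

lemma wsum_wmat [simp]: "wsum G (wmat k) = G k"
  by (cases k) (simp_all add: wsum_def wcoord_wmat del: wcoord.simps wmat.simps)

lemma wsum_zero [simp]: "wsum G 0 = 0"
  by (simp add: wsum_def)

lemma wsum_comm: "wsum (\<lambda>k. wsum (G k) A) B = wsum (\<lambda>l. wsum (\<lambda>k. G k l) B) A"
  by (simp add: wsum_def free.scale_right_distrib add_ac mult.commute del: wcoord.simps)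

text \<open>
  Multiplying the basis elements before or after expanding makes no difference, because the
  coordinates are those of a basis of \<open>UT2\<close>. The matrices have to be upper triangular since the
  coordinates ignore the entry in position \<open>(2, 1)\<close>.
\<close>

lemma wsum_left:
  assumes "A \<in> UT2" "X \<in> UT2"
  shows "wsum (\<lambda>k. wsum G (A ** wmat k)) X = wsum G (A ** X)"
  by (rule poly_mapping_eqI)
     (use assms in \<open>simp add: wsum_def lookup_add lookup_fscale mat2_mult UT2_def e11_def e22_def
        e12_def algebra_simps\<close>)

lemma wsum_right:
  assumes "A \<in> UT2" "X \<in> UT2"
  shows "wsum (\<lambda>k. wsum G (wmat k ** A)) X = wsum G (X ** A)"
  by (rule poly_mapping_eqI)
     (use assms in \<open>simp add: wsum_def lookup_add lookup_fscale mat2_mult UT2_def e11_def e22_def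
        e12_def algebra_simps\<close>)

lemma lact_wsum: "lact A (wsum G X) = wsum (\<lambda>k. lact A (G k)) X"
  by (simp add: wsum_def lact_add lact_scale del: wcoord.simps)

lemma ract_wsum: "ract (wsum G X) A = wsum (\<lambda>k. ract (G k) A) X"
  by (simp add: wsum_def ract_add ract_scale del: wcoord.simps)

lemma fmult_wsum_left: "fmult (wsum G X) f = wsum (\<lambda>k. fmult (G k) f) X"
  by (simp add: wsum_def fmult_add_left fmult_scale_left del: wcoord.simps)

lemma fmult_wsum_right: "fmult f (wsum G X) = wsum (\<lambda>k. fmult f (G k)) X"
  by (simp add: wsum_def fmult_add_right fmult_scale_right del: wcoord.simps)

lemma lact_Mon: "lact A (fmono (Mon a u s b)) = wsum (\<lambda>k. fmono (Mon k u s b)) (A ** wmat a)"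
  by (simp add: lact_fmono wsum_def del: wcoord.simps wmat.simps)

lemma ract_Mon: "ract (fmono (Mon a u s b)) A = wsum (\<lambda>k. fmono (Mon a u s k)) (wmat b ** A)"
  by (simp add: ract_fmono wsum_def del: wcoord.simps wmat.simps)

lemma fmult_Mon: "fmult (fmono (Mon a u s b)) (fmono (Mon c v t d)) =
    wsum (\<lambda>k. fmono (Mon a u (s @ (k, v) # t) d)) (wmat b ** wmat c)"
  by (simp add: fmult_fmono wsum_def del: wcoord.simps wmat.simps)

lemmas act_Mon = lact_Mon ract_Mon fmult_Mon
lemmas act_wsum = lact_wsum ract_wsum fmult_wsum_left fmult_wsum_right
lemmas act_add = lact_add ract_add fmult_add_left fmult_add_right
lemmas act_scale = lact_scale ract_scale fmult_scale_left fmult_scale_right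

text \<open>
  The free algebra is associative and a \<open>W\<close>-bimodule. On monomials, each law below either says that
  the two matrices placed at one slot may be multiplied first (\<open>wsum_left\<close>, \<open>wsum_right\<close>), or that
  expansions at two different slots commute (\<open>wsum_comm\<close>).
\<close>

lemma lact_lact:
  assumes "A \<in> UT2" "B \<in> UT2"
  shows "lact A (lact B f) = lact (A ** B) f"
proof (induction f rule: free_induct)
  case (mono m)
  show ?case using assms
    by (cases m) (simp add: act_Mon act_wsum wsum_left UT2_mult matrix_mul_assoc)
qed (simp_all add: act_add act_scale)

lemma ract_ract:
  assumes "A \<in> UT2" "B \<in> UT2"
  shows "ract (ract f A) B = ract f (A ** B)"
proof (induction f rule: free_induct)
  case (mono m)
  show ?case using assms
    by (cases m) (simp add: act_Mon act_wsum wsum_right UT2_mult matrix_mul_assoc)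
qed (simp_all add: act_add act_scale)

lemma ract_lact: "ract (lact A f) B = lact A (ract f B)"
proof (induction f rule: free_induct)
  case (mono m)
  show ?case by (cases m) (simp add: act_Mon act_wsum, rule wsum_comm)
qed (simp_all add: act_add act_scale)

lemma lact_fmult: "lact A (fmult f g) = fmult (lact A f) g"
proof (induction f rule: free_induct)
  case (mono m)
  show ?case
  proof (induction g rule: free_induct)
    case (mono n)
    show ?case by (cases m; cases n) (simp add: act_Mon act_wsum, rule wsum_comm)
  qed (simp_all add: act_add act_scale)
qed (simp_all add: act_add act_scale)

lemma ract_fmult: "ract (fmult f g) A = fmult f (ract g A)"
proof (induction f rule: free_induct)
  case (mono m)
  show ?case
  proof (induction g rule: free_induct)
    case (mono n)
    show ?case by (cases m; cases n) (simp add: act_Mon act_wsum, rule wsum_comm)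
  qed (simp_all add: act_add act_scale)
qed (simp_all add: act_add act_scale)

lemma fmult_ract_lact:
  assumes "A \<in> UT2"
  shows "fmult (ract f A) g = fmult f (lact A g)"
proof (induction f rule: free_induct)
  case (mono m)
  show ?case
  proof (induction g rule: free_induct)
    case (mono n)
    show ?case using assms
      by (cases m; cases n)
         (simp add: act_Mon act_wsum wsum_left wsum_right UT2_mult matrix_mul_assoc)
  qed (simp_all add: act_add act_scale)
qed (simp_all add: act_add act_scale)

lemma fmult_assoc: "fmult (fmult f g) h = fmult f (fmult g h)"
proof (induction f rule: free_induct)
  case (mono l)
  show ?case
  proof (induction g rule: free_induct)
    case (mono m)
    show ?case
    proof (induction h rule: free_induct)
      case (mono n)
      show ?case by (cases l; cases m; cases n) (simp add: act_Mon act_wsum, rule wsum_comm)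
    qed (simp_all add: act_add act_scale)
  qed (simp_all add: act_add act_scale)
qed (simp_all add: act_add act_scale)

lemma ract_mat1: "ract f (mat 1) = f"
proof (induction f rule: free_induct)
  case (mono m)
  show ?case by (cases m) (simp add: act_Mon)
qed (simp_all add: act_add act_scale)

lemma lact_mat_0 [simp]: "lact 0 f = 0"
proof (induction f rule: free_induct)
  case (mono m)
  show ?case by (cases m) (simp add: act_Mon)
qed (simp_all add: act_add act_scale)

lemma ract_mat_0 [simp]: "ract f 0 = 0"
proof (induction f rule: free_induct)
  case (mono m)
  show ?case by (cases m) (simp add: act_Mon)
qed (simp_all add: act_add act_scale)

text \<open>
  Every monomial is built from left to right, by multiplying alternately with a variable and with
  a basis element of \<open>W\<close>.
\<close>

lemma fmono_start: "fmono (Mon a u [] W_one) = lact (wmat a) (fvar u)"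
  by (simp add: fvar_def lact_Mon wmat_one del: wmat.simps)

lemma fmono_ract: "fmono (Mon a u s b) = ract (fmono (Mon a u s W_one)) (wmat b)"
  by (simp add: ract_Mon wmat_one del: wmat.simps)

lemma fmono_snoc: "fmono (Mon a u (s @ [(w, v)]) W_one) = fmult (fmono (Mon a u s w)) (fvar v)"
  by (simp add: fvar_def fmult_Mon wmat_one del: wmat.simps)

lemma monom_induct [case_names start ract snoc]:
  assumes start: "\<And>a u. P (Mon a u [] W_one)"
    and ract: "\<And>a u s b. P (Mon a u s W_one) \<Longrightarrow> P (Mon a u s b)"
    and snoc: "\<And>a u s w v. P (Mon a u s w) \<Longrightarrow> P (Mon a u (s @ [(w, v)]) W_one)"
  shows "P m"
proof -
  have "P (Mon a u s W_one)" for a u s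
  proof (induction s rule: rev_induct)
    case (snoc p s)
    then show ?case by (cases p) (auto intro: assms)
  qed (rule start)
  then show ?thesis by (cases m) (auto intro: ract)
qed

section \<open>Normal forms of monomials\<close>

text \<open>
  A monomial is read from left to right and multiplied out modulo the four relations. As long as
  only variables \<open>y\<close> have occurred the product is a commutative monomial \<open>y\<^sup>M\<close>, recorded as
  \<open>NDiag M\<close>. After a factor \<open>e22\<close> it is \<open>y\<^sup>M e22\<close>, recorded as \<open>NLow M\<close>; a further \<open>e12\<close> or
  \<open>z\<close> then kills it. A single factor \<open>e12\<close> or \<open>z\<^sub>k\<close> leads from \<open>NDiag M\<close> to \<open>y\<^sup>M e12 y\<^sup>N\<close> or
  \<open>y\<^sup>M z\<^sub>k y\<^sup>N\<close>, recorded as \<open>NUp M None N\<close> and \<open>NUp M (Some k) N\<close>; here later factors \<open>e22\<close>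
  are absorbed and a second \<open>e12\<close> or \<open>z\<close> gives zero. The two functions \<open>step_w\<close> and \<open>step_v\<close> are
  the transitions of this automaton.
\<close>

datatype nform = NZero | NDiag "nat multiset" | NLow "nat multiset"
  | NUp "nat multiset" "nat option" "nat multiset"

fun step_w :: "nform \<Rightarrow> wbasis \<Rightarrow> nform" where
  "step_w s W_one = s"
| "step_w (NDiag M) W_e22 = NLow M"
| "step_w (NDiag M) W_e12 = NUp M None {#}"
| "step_w (NLow M) W_e22 = NLow M"
| "step_w (NUp M c N) W_e22 = NUp M c N"
| "step_w _ _ = NZero"

fun step_v :: "nform \<Rightarrow> var \<Rightarrow> nform" where
  "step_v (NDiag M) (Y i) = NDiag (add_mset i M)"
| "step_v (NDiag M) (Z j) = NUp M (Some j) {#}"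
| "step_v (NLow M) (Y i) = NLow (add_mset i M)"
| "step_v (NUp M c N) (Y i) = NUp M c (add_mset i N)"
| "step_v _ _ = NZero"

fun nf :: "monom \<Rightarrow> nform" where
  "nf (Mon a u s b) =
     step_w (foldl (\<lambda>t (k, v). step_v (step_w t k) v) (step_v (step_w (NDiag {#}) a) u) s) b"

lemma nf_ract: "nf (Mon a u s b) = step_w (nf (Mon a u s W_one)) b"
  and nf_snoc: "nf (Mon a u (s @ [(w, v)]) W_one) = step_v (nf (Mon a u s w)) v"
  by simp_all

text \<open>
  This is the coefficient of the normal form \<open>s\<close> after all monomials of \<open>f\<close> have been reduced.
  Writing it as a sum over all monomials of \<open>f\<close>, with weight 0 or 1, makes it visibly linear.
\<close>

definition nf_coeff :: "nform \<Rightarrow> 'f::field free_walg \<Rightarrow> 'f" where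
  "nf_coeff s f = (\<Sum>m\<in>Poly_Mapping.keys f. Poly_Mapping.lookup f m * (if nf m = s then 1 else 0))"

lemma nf_coeff_eq:
  "nf_coeff s f = (\<Sum>m\<in>{m \<in> Poly_Mapping.keys f. nf m = s}. Poly_Mapping.lookup f m)"
  by (simp add: nf_coeff_def if_distrib sum.inter_filter cong: if_cong)

lemma vector_space_field: "vector_space ((*) :: 'f::field \<Rightarrow> 'f \<Rightarrow> 'f)"
  by unfold_locales (auto simp: algebra_simps)

lemma nf_coeff_zero [simp]: "nf_coeff s 0 = 0"
  by (simp add: nf_coeff_def)

lemma nf_coeff_add: "nf_coeff s (f + g) = nf_coeff s f + nf_coeff s g"
  unfolding nf_coeff_def by (rule sum_keys_add[OF vector_space_field])

lemma nf_coeff_scale: "nf_coeff s (fscale c f) = c * nf_coeff s f"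
  unfolding nf_coeff_def by (rule sum_keys_scale[OF vector_space_field])

lemma nf_coeff_fmono: "nf_coeff s (fmono m) = (if nf m = s then 1 else 0)"
  unfolding nf_coeff_def by (rule sum_keys_fmono[OF vector_space_field])

lemma nf_coeff_diff: "nf_coeff s (f - g) = nf_coeff s f - nf_coeff s g"
  using nf_coeff_add[of s "f - g" g] by simp

lemma nf_coeff_sum: "nf_coeff s (\<Sum>i\<in>A. f i) = (\<Sum>i\<in>A. nf_coeff s (f i))"
  by (induction A rule: infinite_finite_induct) (simp_all add: nf_coeff_add)


section \<open>Renaming variables\<close>

text \<open>
  The relations mention the variables \<open>Y 0\<close>, \<open>Y 1\<close> and \<open>Z 0\<close> only. They hold for all variables
  because a renaming that respects degrees extends to a graded endomorphism.
\<close>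

fun rename_monom :: "(var \<Rightarrow> var) \<Rightarrow> monom \<Rightarrow> monom" where
  "rename_monom r (Mon a u s b) = Mon a (r u) (map (map_prod id r) s) b"

definition rename :: "(var \<Rightarrow> var) \<Rightarrow> 'f::field free_walg \<Rightarrow> 'f free_walg" where
  "rename r = lin_ext (\<lambda>m. fmono (rename_monom r m))"

lemma rename_add: "rename r (f + g) = rename r f + rename r g"
  and rename_scale: "rename r (fscale c f) = fscale c (rename r f)"
  and rename_fmono: "rename r (fmono m) = fmono (rename_monom r m)"
  and rename_zero [simp]: "rename r 0 = 0"
  by (simp_all add: rename_def lin_ext_add lin_ext_scale)

lemma rename_fvar: "rename r (fvar v) = fvar (r v)"
  by (simp add: fvar_def rename_fmono)

lemma rename_wsum: "rename r (wsum G X) = wsum (\<lambda>k. rename r (G k)) X"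
  by (simp add: wsum_def rename_add rename_scale del: wcoord.simps)

lemma mdeg_rename:
  assumes "\<And>v. vdeg (r v) = vdeg v"
  shows "mdeg (rename_monom r m) = mdeg m"
proof (cases m)
  case (Mon a u s b)
  have "(\<lambda>(k, v). wdeg k + vdeg v) \<circ> map_prod id r = (\<lambda>(k, v). wdeg k + vdeg v)"
    using assms by auto
  with assms Mon show ?thesis by simp
qed

lemma graded_W_endo_rename:
  assumes "\<And>v. vdeg (r v) = vdeg v"
  shows "graded_W_endo (rename r :: 'f::field free_walg \<Rightarrow> _)"
  unfolding graded_W_endo_def
proof (intro conjI allI ballI)
  fix f g :: "'f free_walg"
  show "rename r (fmult f g) = fmult (rename r f) (rename r g)"
  proof (induction f rule: free_induct)
    case (mono m)
    show ?case
    proof (induction g rule: free_induct)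
      case (mono n)
      show ?case by (cases m; cases n) (simp add: act_Mon rename_fmono rename_wsum)
    qed (simp_all add: act_add act_scale rename_add rename_scale)
  qed (simp_all add: act_add act_scale rename_add rename_scale)
next
  fix f :: "'f free_walg" and A :: "'f^2^2"
  show "rename r (lact A f) = lact A (rename r f)"
  proof (induction f rule: free_induct)
    case (mono m)
    show ?case by (cases m) (simp add: act_Mon rename_fmono rename_wsum)
  qed (simp_all add: act_add act_scale rename_add rename_scale)
  show "rename r (ract f A) = ract (rename r f) A"
  proof (induction f rule: free_induct)
    case (mono m)
    show ?case by (cases m) (simp add: act_Mon rename_fmono rename_wsum)
  qed (simp_all add: act_add act_scale rename_add rename_scale)
next
  fix d
  show "rename r ` (free_component d :: 'f free_walg set) \<subseteq> free_component d"
  proof safe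
    fix f :: "'f free_walg"
    assume "f \<in> free_component d"
    then show "rename r f \<in> free_component d"
      unfolding free_component_def
    proof (induction rule: free.span_induct)
      case base
      show ?case
        by (auto simp: free.subspace_def rename_add rename_scale
            intro: free.span_zero free.span_add free.span_scale)
    next
      case (step f)
      then show ?case
        by (auto simp: rename_fmono mdeg_rename[OF assms] intro!: free.span_base)
    qed
  qed
qed (simp_all add: rename_add rename_scale)


lemma graded_W_endo_diff:
  assumes "graded_W_endo \<phi>"
  shows "\<phi> (f - g) = \<phi> f - \<phi> g"
proof -
  have "\<phi> (f - g + g) = \<phi> (f - g) + \<phi> g"
    using assms unfolding graded_W_endo_def by blast
  then show ?thesis by simp
qed


section \<open>Reduction to normal form modulo the relations\<close>

text \<open>
  One renaming serves all four relations: it sends \<open>Y 0\<close>, \<open>Y 1\<close> and \<open>Z 0\<close> to \<open>Y i\<close>, \<open>Y j\<close> and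
  \<open>Z k\<close>.
\<close>

definition yz_renaming :: "nat \<Rightarrow> nat \<Rightarrow> nat \<Rightarrow> var \<Rightarrow> var" where
  "yz_renaming i j k v = (case v of Y n \<Rightarrow> Y (if n = 0 then i else j) | Z n \<Rightarrow> Z k)"

type_synonym 'f unital_walg = "('f^2^2) \<times> 'f free_walg"

locale relation_ideal =
  fixes J :: "'f::field free_walg set"
  assumes ideal: "TW_ideal J"
    and rel_comm: "fcomm (fvar (Y 0)) (fvar (Y 1)) \<in> J"
    and rel_slide: "lact e22 (fvar (Y 0)) - ract (fvar (Y 0)) e22 \<in> J"
    and rel_right: "ract (fvar (Z 0)) e22 - fvar (Z 0) \<in> J"
    and rel_left: "lact e22 (fvar (Z 0)) \<in> J"
begin

lemma subspace: "free.subspace J"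
  and mult_left: "f \<in> J \<Longrightarrow> fmult g f \<in> J"
  and mult_right: "f \<in> J \<Longrightarrow> fmult f g \<in> J"
  and act_left: "A \<in> UT2 \<Longrightarrow> f \<in> J \<Longrightarrow> lact A f \<in> J"
  and act_right: "A \<in> UT2 \<Longrightarrow> f \<in> J \<Longrightarrow> ract f A \<in> J"
  and endo: "graded_W_endo \<phi> \<Longrightarrow> f \<in> J \<Longrightarrow> \<phi> f \<in> J"
  using ideal unfolding TW_ideal_def by blast+

lemma graded_W_endo_yz_renaming: "graded_W_endo (rename (yz_renaming i j k) :: 'f free_walg \<Rightarrow> 'f free_walg)"
  by (rule graded_W_endo_rename) (simp add: yz_renaming_def split: var.split)

lemma rename_closed:
  assumes "f \<in> J"
  shows "rename (yz_renaming i j k) f \<in> J"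
  using graded_W_endo_yz_renaming assms by (rule endo)

lemma relations:
  "fcomm (fvar (Y i)) (fvar (Y j)) \<in> J"
  "lact e22 (fvar (Y i)) - ract (fvar (Y i)) e22 \<in> J"
  "ract (fvar (Z k)) e22 - fvar (Z k) \<in> J"
  "lact e22 (fvar (Z k)) \<in> J"
proof -
  note endo = graded_W_endo_yz_renaming[of i j k]
  have hom: "rename (yz_renaming i j k) (fmult f g) =
      fmult (rename (yz_renaming i j k) f) (rename (yz_renaming i j k) g)"
    "rename (yz_renaming i j k) (lact e22 f) = lact e22 (rename (yz_renaming i j k) f)"
    "rename (yz_renaming i j k) (ract f e22) = ract (rename (yz_renaming i j k) f) e22"
    for f g :: "'f free_walg"
    using endo e22_UT2 unfolding graded_W_endo_def by blast+
  show "fcomm (fvar (Y i)) (fvar (Y j)) \<in> J"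
    "lact e22 (fvar (Y i)) - ract (fvar (Y i)) e22 \<in> J"
    "ract (fvar (Z k)) e22 - fvar (Z k) \<in> J"
    "lact e22 (fvar (Z k)) \<in> J"
    using rel_comm[THEN rename_closed, of i j k] rel_slide[THEN rename_closed, of i j k]
      rel_right[THEN rename_closed, of i j k] rel_left[THEN rename_closed, of i j k]
    by (simp_all add: fcomm_def hom graded_W_endo_diff[OF endo] rename_fvar yz_renaming_def)
qed

text \<open>
  The free algebra has no unit, so an empty prefix of a monomial, or one that consists of an element
  of \<open>W\<close> alone, is not one of its elements. Pairs \<open>(A, f)\<close>, standing for \<open>A + f\<close> in the unital
  algebra \<open>W \<oplus> W\<langle>Y, Z\<rangle>\<close>, give every prefix a meaning. The maps \<open>pvar v\<close> and \<open>pmat B\<close> are right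
  multiplication by a variable and by an element of \<open>W\<close>, and \<open>\<approx>\<close> is congruence modulo
  \<open>{0} \<times> J\<close>, restricted to \<open>A \<in> UT2\<close>.
\<close>

definition pvar :: "var \<Rightarrow> 'f unital_walg \<Rightarrow> 'f unital_walg" where
  "pvar v p = (0, lact (fst p) (fvar v) + fmult (snd p) (fvar v))"

definition pmat :: "'f^2^2 \<Rightarrow> 'f unital_walg \<Rightarrow> 'f unital_walg" where
  "pmat B p = (fst p ** B, ract (snd p) B)"

definition cong :: "'f unital_walg \<Rightarrow> 'f unital_walg \<Rightarrow> bool" (infix "\<approx>" 50) where
  "p \<approx> q \<longleftrightarrow> fst p \<in> UT2 \<and> fst p = fst q \<and> snd p - snd q \<in> J"

lemma zero_UT2 [simp]: "(0 :: 'f^2^2) \<in> UT2"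
  by (simp add: UT2_def)

lemma fst_pvar [simp]: "fst (pvar v p) = 0"
  by (simp add: pvar_def)

lemma pmat_UT2 [simp]: "fst p \<in> UT2 \<Longrightarrow> B \<in> UT2 \<Longrightarrow> fst (pmat B p) \<in> UT2"
  by (simp add: pmat_def UT2_mult)

lemma cong_refl [simp]: "fst p \<in> UT2 \<Longrightarrow> p \<approx> p"
  using free.subspace_0[OF subspace] by (simp add: cong_def)

lemma cong_sym: "p \<approx> q \<Longrightarrow> q \<approx> p"
  using free.subspace_neg[OF subspace, of "snd p - snd q"] by (auto simp: cong_def)

lemma cong_trans [trans]: "p \<approx> q \<Longrightarrow> q \<approx> r \<Longrightarrow> p \<approx> r"
  using free.subspace_add[OF subspace, of "snd p - snd q" "snd q - snd r"] by (auto simp: cong_def)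

lemma cong_pvar: "p \<approx> q \<Longrightarrow> pvar v p \<approx> pvar v q"
  using mult_right[of "snd p - snd q" "fvar v"] by (auto simp: cong_def pvar_def fmult_minus_left)

lemma cong_pmat: "p \<approx> q \<Longrightarrow> B \<in> UT2 \<Longrightarrow> pmat B p \<approx> pmat B q"
  using act_right[of B "snd p - snd q"] by (auto simp: cong_def pmat_def ract_minus UT2_mult)

text \<open>
  This is left multiplication of a relation by the pair \<open>(A, g)\<close>; each of the next four lemmas
  applies it to one of the relations.
\<close>

lemma relation_context:
  assumes "f \<in> J" "A \<in> UT2"
  shows "lact A f + fmult g f \<in> J"
  using assms act_left mult_left free.subspace_add[OF subspace] by blast

lemma pvar_comm:
  assumes "fst p \<in> UT2"
  shows "pvar (Y i) (pvar (Y j) p) \<approx> pvar (Y j) (pvar (Y i) p)"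
  using relation_context[OF relations(1)[of j i] assms, of "snd p"]
  by (simp add: cong_def pvar_def fcomm_def lact_minus fmult_minus_right fmult_add_left
      lact_fmult fmult_assoc algebra_simps)

lemma pvar_e22:
  assumes "fst p \<in> UT2"
  shows "pvar (Y i) (pmat e22 p) \<approx> pmat e22 (pvar (Y i) p)"
  using relation_context[OF relations(2)[of i] assms, of "snd p"] assms
  by (simp add: cong_def pvar_def pmat_def lact_minus fmult_minus_right ract_add ract_lact
      ract_fmult lact_lact fmult_ract_lact algebra_simps)

lemma pvar_Z_e22:
  assumes "fst p \<in> UT2"
  shows "pmat e22 (pvar (Z k) p) \<approx> pvar (Z k) p"
  using relation_context[OF relations(3)[of k] assms, of "snd p"] assms
  by (simp add: cong_def pvar_def pmat_def lact_minus fmult_minus_right ract_add ract_lact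
      ract_fmult algebra_simps)

lemma e22_pvar_Z:
  assumes "fst p \<in> UT2"
  shows "pvar (Z k) (pmat e22 p) \<approx> (0, 0)"
  using relation_context[OF relations(4)[of k] assms, of "snd p"] assms
  by (simp add: cong_def pvar_def pmat_def lact_lact fmult_ract_lact)

lemma pmat_pmat: "fst p \<in> UT2 \<Longrightarrow> A \<in> UT2 \<Longrightarrow> B \<in> UT2 \<Longrightarrow> pmat B (pmat A p) = pmat (A ** B) p"
  by (simp add: pmat_def ract_ract matrix_mul_assoc)

lemma pmat_0 [simp]: "pmat 0 p = (0, 0)"
  by (simp add: pmat_def)

lemma pmat_zero [simp]: "pmat B (0, 0) = (0, 0)"
  by (simp add: pmat_def)

lemma pvar_zero [simp]: "pvar v (0, 0) = (0, 0)"
  by (simp add: pvar_def)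

lemma pmat_one [simp]: "pmat (mat 1) p = p"
  by (simp add: pmat_def ract_mat1)

definition mult_ys :: "nat list \<Rightarrow> 'f unital_walg \<Rightarrow> 'f unital_walg" where
  "mult_ys xs p = foldl (\<lambda>p i. pvar (Y i) p) p xs"

lemma mult_ys_simps [simp]: "mult_ys [] p = p" "mult_ys (x # xs) p = mult_ys xs (pvar (Y x) p)"
  by (simp_all add: mult_ys_def)

lemma mult_ys_append: "mult_ys (xs @ xs') p = mult_ys xs' (mult_ys xs p)"
  by (simp add: mult_ys_def)

lemma mult_ys_UT2 [simp]: "fst p \<in> UT2 \<Longrightarrow> fst (mult_ys xs p) \<in> UT2"
  by (induction xs arbitrary: p) auto

lemma cong_ys: "p \<approx> q \<Longrightarrow> mult_ys xs p \<approx> mult_ys xs q"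
proof (induction xs arbitrary: p q)
  case (Cons x xs)
  show ?case using Cons.IH[OF cong_pvar[OF Cons.prems]] by simp
qed simp

lemma mult_ys_front:
  assumes "fst p \<in> UT2"
  shows "mult_ys (xs @ x # xs') p \<approx> mult_ys (x # xs @ xs') p"
  using assms
proof (induction xs arbitrary: p)
  case (Cons z xs)
  have "mult_ys ((z # xs) @ x # xs') p \<approx> mult_ys (x # xs @ xs') (pvar (Y z) p)"
    using Cons.IH[of "pvar (Y z) p"] by simp
  also have "\<dots> \<approx> mult_ys (x # (z # xs) @ xs') p"
    using Cons.prems by (auto intro!: cong_ys pvar_comm)
  finally show ?case .
qed simp

text \<open>
  By commutativity of the \<open>y\<close> the word matters only up to permutation. This is what makes the
  choice of sorted words in the normal form harmless.
\<close>

lemma mult_ys_perm: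
  assumes "fst p \<in> UT2" "mset xs = mset xs'"
  shows "mult_ys xs p \<approx> mult_ys xs' p"
  using assms
proof (induction xs arbitrary: p xs')
  case (Cons x xs)
  then have "x \<in> set xs'" by (metis list.set_intros(1) set_mset_mset)
  then obtain as bs where xs': "xs' = as @ x # bs" by (meson split_list)
  with Cons.prems have "mult_ys (x # xs) p \<approx> mult_ys (x # as @ bs) p"
    using Cons.IH[of "pvar (Y x) p" "as @ bs"] by simp
  also have "\<dots> \<approx> mult_ys xs' p"
    unfolding xs' using Cons.prems(1) by (intro cong_sym[OF mult_ys_front])
  finally show ?case .
qed simp

lemma mult_ys_e22:
  assumes "fst p \<in> UT2"
  shows "mult_ys xs (pmat e22 p) \<approx> pmat e22 (mult_ys xs p)"
  using assms
proof (induction xs arbitrary: p)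
  case (Cons x xs)
  have "mult_ys (x # xs) (pmat e22 p) \<approx> mult_ys xs (pmat e22 (pvar (Y x) p))"
    using Cons.prems by (auto intro: cong_ys pvar_e22)
  also have "\<dots> \<approx> pmat e22 (mult_ys (x # xs) p)"
    using Cons.IH by simp
  finally show ?case .
qed simp

abbreviation mult_yms :: "nat multiset \<Rightarrow> 'f unital_walg \<Rightarrow> 'f unital_walg" where
  "mult_yms M \<equiv> mult_ys (sorted_list_of_multiset M)"

fun canon :: "nform \<Rightarrow> 'f unital_walg" where
  "canon NZero = (0, 0)"
| "canon (NDiag M) = mult_yms M (mat 1, 0)"
| "canon (NLow M) = pmat e22 (mult_yms M (mat 1, 0))"
| "canon (NUp M None N) = mult_yms N (pmat e12 (mult_yms M (mat 1, 0)))"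
| "canon (NUp M (Some k) N) = mult_yms N (pvar (Z k) (mult_yms M (mat 1, 0)))"

lemma canon_UT2 [simp]: "fst (canon s) \<in> UT2"
  by (cases s rule: canon.cases) (simp_all add: UT2_mat1)

lemma pvar_mult_yms:
  assumes "fst p \<in> UT2"
  shows "pvar (Y i) (mult_yms M p) \<approx> mult_yms (add_mset i M) p"
proof -
  have "pvar (Y i) (mult_yms M p) = mult_ys (sorted_list_of_multiset M @ [i]) p"
    by (simp add: mult_ys_append)
  also have "\<dots> \<approx> mult_yms (add_mset i M) p"
    using assms by (rule mult_ys_perm) (simp only: mset_append mset_sorted_list_of_multiset, simp)
  finally show ?thesis .
qed

text \<open>
  Once a factor \<open>e12\<close> or \<open>z\<close> has occurred, \<open>e22\<close> acts as the identity from the right: it moves to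
  the left through the variables \<open>y\<close> until it meets that factor, where \<open>e12 e22 = e12\<close> or
  \<open>z e22 = z\<close>.
\<close>

lemma canon_NUp_e22: "pmat e22 (canon (NUp M c N)) \<approx> canon (NUp M c N)"
proof -
  obtain p where p: "fst p \<in> UT2" "canon (NUp M c N) = mult_yms N p" "pmat e22 p \<approx> p"
  proof (cases c)
    case None
    then show ?thesis
      using that[of "pmat e12 (mult_yms M (mat 1, 0))"] by (simp add: pmat_pmat e12_e22 UT2_mat1)
  next
    case (Some k)
    then show ?thesis
      using that[of "pvar (Z k) (mult_yms M (mat 1, 0))"] by (simp add: pvar_Z_e22 UT2_mat1)
  qed
  have "pmat e22 (mult_yms N p) \<approx> mult_yms N (pmat e22 p)"
    using p(1) by (intro cong_sym[OF mult_ys_e22])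
  also have "\<dots> \<approx> mult_yms N p"
    using p(3) by (rule cong_ys)
  finally show ?thesis using p(2) by simp
qed

text \<open>
  The transitions of the automaton are sound modulo \<open>J\<close>. A prefix of the form \<open>NLow M\<close>
  ends in \<open>e22\<close>, and to one of the form \<open>NUp M c N\<close> an \<open>e22\<close> may be appended by
  \<open>canon_NUp_e22\<close>; so \<open>e22 e12 = 0\<close> here, and \<open>e22 z = 0\<close> in \<open>canon_step_v\<close>, account for the
  transitions to zero.
\<close>

lemma canon_step_w: "pmat (wmat w) (canon s) \<approx> canon (step_w s w)"
proof (cases w)
  case W_one
  then show ?thesis by (simp add: wmat_one del: wmat.simps)
next
  case W_e22
  then show ?thesis using canon_NUp_e22
    by (cases s) (simp_all add: pmat_pmat e22_e22 UT2_mat1)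
next
  case W_e12
  have "pmat e12 (canon (NUp M c N)) \<approx> (0, 0)" for M c N
  proof -
    have "pmat e12 (canon (NUp M c N)) \<approx> pmat e12 (pmat e22 (canon (NUp M c N)))"
      by (intro cong_pmat cong_sym[OF canon_NUp_e22]) simp
    then show ?thesis by (simp add: pmat_pmat e22_e12)
  qed
  with W_e12 show ?thesis
    by (cases s) (simp_all add: pmat_pmat e22_e12 UT2_mat1)
qed

lemma canon_step_v: "pvar v (canon s) \<approx> canon (step_v s v)"
proof (cases s)
  case NZero
  then show ?thesis by (cases v) simp_all
next
  case (NDiag M)
  then show ?thesis by (cases v) (simp_all add: pvar_mult_yms UT2_mat1 del: sorted_list_of_multiset_insert)
next
  case (NLow M)
  show ?thesis
  proof (cases v)
    case (Y i)
    have "pvar (Y i) (canon (NLow M)) \<approx> pmat e22 (pvar (Y i) (mult_yms M (mat 1, 0)))"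
      by (simp add: pvar_e22 UT2_mat1)
    also have "\<dots> \<approx> canon (NLow (add_mset i M))"
      using cong_pmat[OF pvar_mult_yms] by (simp add: UT2_mat1)
    finally show ?thesis using NLow Y by simp
  qed (use NLow in \<open>simp add: e22_pvar_Z UT2_mat1\<close>)
next
  case (NUp M c N)
  show ?thesis
  proof (cases v)
    case (Y i)
    with NUp show ?thesis by (cases c) (simp_all add: pvar_mult_yms UT2_mat1 del: sorted_list_of_multiset_insert)
  next
    case (Z k)
    have "pvar (Z k) (canon s) \<approx> pvar (Z k) (pmat e22 (canon s))"
      unfolding NUp by (intro cong_pvar cong_sym[OF canon_NUp_e22])
    also have "\<dots> \<approx> (0, 0)"
      by (simp add: e22_pvar_Z)
    finally show ?thesis using NUp Z by simp
  qed
qed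

lemma fmono_canon: "(0, fmono m) \<approx> canon (nf m)"
proof (induction m rule: monom_induct)
  case (start a u)
  have "(0, fmono (Mon a u [] W_one)) = pvar u (pmat (wmat a) (canon (NDiag {#})))"
    by (simp add: pvar_def pmat_def fmono_start del: wmat.simps)
  also have "\<dots> \<approx> pvar u (canon (step_w (NDiag {#}) a))"
    by (intro cong_pvar canon_step_w)
  also have "\<dots> \<approx> canon (step_v (step_w (NDiag {#}) a) u)"
    by (rule canon_step_v)
  finally show ?case by simp
next
  case (ract a u s b)
  have "(0, fmono (Mon a u s b)) = pmat (wmat b) (0, fmono (Mon a u s W_one))"
    by (subst fmono_ract) (simp add: pmat_def)
  also have "\<dots> \<approx> pmat (wmat b) (canon (nf (Mon a u s W_one)))"
    using ract by (intro cong_pmat) simp_all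
  also have "\<dots> \<approx> canon (nf (Mon a u s b))"
    unfolding nf_ract[of a u s b] by (rule canon_step_w)
  finally show ?case .
next
  case (snoc a u s w v)
  have "(0, fmono (Mon a u (s @ [(w, v)]) W_one)) = pvar v (0, fmono (Mon a u s w))"
    by (subst fmono_snoc) (simp add: pvar_def)
  also have "\<dots> \<approx> pvar v (canon (nf (Mon a u s w)))"
    using snoc by (intro cong_pvar)
  also have "\<dots> \<approx> canon (nf (Mon a u (s @ [(w, v)]) W_one))"
    unfolding nf_snoc by (rule canon_step_v)
  finally show ?case .
qed

text \<open>
  Grouping the monomials of \<open>f\<close> by normal form shows that \<open>f\<close> lies in the ideal as soon as the
  coefficients belonging to each nonzero normal form add up to zero.
\<close>

lemma mem_ideal:
  fixes f :: "'f free_walg"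
  assumes "\<And>s. s \<noteq> NZero \<Longrightarrow> nf_coeff s f = 0"
  shows "f \<in> J"
proof -
  let ?K = "Poly_Mapping.keys f" and ?c = "Poly_Mapping.lookup f"
  have "f - (\<Sum>m\<in>?K. fscale (?c m) (snd (canon (nf m)))) =
      (\<Sum>m\<in>?K. fscale (?c m) (fmono m - snd (canon (nf m))))"
    by (subst free_expand[of f]) (simp add: free.scale_right_diff_distrib sum_subtractf)
  also have "\<dots> \<in> J"
    using fmono_canon
    by (intro free.subspace_sum[OF subspace] free.subspace_scale[OF subspace]) (simp add: cong_def)
  also have "(\<Sum>m\<in>?K. fscale (?c m) (snd (canon (nf m)))) =
      (\<Sum>s\<in>nf ` ?K. \<Sum>m\<in>{m \<in> ?K. nf m = s}. fscale (?c m) (snd (canon (nf m))))"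
    by (rule sum.image_gen) simp
  also have "\<dots> = (\<Sum>s\<in>nf ` ?K. fscale (nf_coeff s f) (snd (canon s)))"
    by (simp add: nf_coeff_eq free.scale_sum_left)
  also have "\<dots> = 0"
    by (intro sum.neutral ballI) (metis assms canon.simps(1) free.scale_zero_left free.scale_zero_right snd_conv)
  finally show ?thesis by simp
qed

end

section \<open>Evaluation\<close>

lemma smat_mult_left: "smat c A ** B = smat c (A ** B)"
  and smat_mult_right: "A ** smat c B = smat c (A ** B)"
  by (simp_all add: vec_eq_iff smat_def mat2_mult algebra_simps)

lemma mult_add_left: "(A + B) ** C = A ** C + B ** C"
  and mult_add_right: "A ** (B + C) = A ** B + A ** C"
  for A B C :: "'f::field^2^2"
  by (simp_all add: vec_eq_iff mat2_mult algebra_simps)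

lemma eval_wsum:
  assumes "\<And>k. eval_at \<rho> (G k) = P ** wmat k ** Q" "X \<in> UT2"
  shows "eval_at \<rho> (wsum G X) = P ** X ** Q"
proof -
  have "eval_at \<rho> (wsum G X) =
      (\<Sum>k\<in>{W_one, W_e22, W_e12}. smat (wcoord X k) (P ** wmat k ** Q))"
    by (simp add: wsum_def eval_add eval_scale assms(1) del: wcoord.simps)
  also have "\<dots> = P ** (\<Sum>k\<in>{W_one, W_e22, W_e12}. smat (wcoord X k) (wmat k)) ** Q"
    by (simp add: smat_mult_left smat_mult_right mult_add_right mult_add_left
        del: wcoord.simps wmat.simps)
  finally show ?thesis by (simp add: wcoord_expand[OF assms(2), symmetric])
qed

text \<open>
  The leftmost factor of an evaluated monomial can be pulled out in front. This gives evaluation at a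
  monomial the shape \<open>P ** wmat k ** Q\<close> with respect to any slot \<open>k\<close>, as \<open>eval_wsum\<close> requires.
\<close>

lemma foldl_mon_eval:
  "foldl (\<lambda>P (k, v). P ** wmat k ** \<rho> v) (A ** B) s =
    A ** foldl (\<lambda>P (k, v). P ** wmat k ** \<rho> v) B s"
proof (induction s arbitrary: B)
  case (Cons p s)
  obtain k v where "p = (k, v)" by fastforce
  then show ?case using Cons[of "B ** wmat k ** \<rho> v"] by (simp add: matrix_mul_assoc)
qed simp

lemma mon_eval_left: "mon_eval \<rho> (Mon a u s b) =
    wmat a ** (foldl (\<lambda>P (k, v). P ** wmat k ** \<rho> v) (\<rho> u) s ** wmat b)"
  by (simp add: foldl_mon_eval matrix_mul_assoc)

lemma eval_lact: "A \<in> UT2 \<Longrightarrow> eval_at \<rho> (lact A f) = A ** eval_at \<rho> f"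
proof (induction f rule: free_induct)
  case (mono m)
  obtain a u s b where m: "m = Mon a u s b" by (cases m)
  let ?Q = "foldl (\<lambda>P (k, v). P ** wmat k ** \<rho> v) (\<rho> u) s ** wmat b"
  have "eval_at \<rho> (lact A (fmono m)) = mat 1 ** (A ** wmat a) ** ?Q"
    unfolding m lact_Mon using mono
    by (intro eval_wsum) (simp_all add: mon_eval_left UT2_mult del: mon_eval.simps)
  then show ?case by (simp add: m mon_eval_left matrix_mul_assoc del: mon_eval.simps)
qed (simp_all add: act_add act_scale eval_add eval_scale mult_add_right smat_mult_right)

lemma eval_ract: "A \<in> UT2 \<Longrightarrow> eval_at \<rho> (ract f A) = eval_at \<rho> f ** A"
proof (induction f rule: free_induct)
  case (mono m)
  obtain a u s b where m: "m = Mon a u s b" by (cases m)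
  let ?P = "foldl (\<lambda>P (k, v). P ** wmat k ** \<rho> v) (wmat a ** \<rho> u) s"
  have "eval_at \<rho> (ract (fmono m) A) = ?P ** (wmat b ** A) ** mat 1"
    unfolding m ract_Mon using mono by (intro eval_wsum) (simp_all add: UT2_mult)
  then show ?case by (simp add: m matrix_mul_assoc)
qed (simp_all add: act_add act_scale eval_add eval_scale mult_add_left smat_mult_left)

lemma eval_fmult: "eval_at \<rho> (fmult f g) = eval_at \<rho> f ** eval_at \<rho> g"
proof (induction f rule: free_induct)
  case (mono m)
  show ?case
  proof (induction g rule: free_induct)
    case (mono n)
    obtain a u s b where m: "m = Mon a u s b" by (cases m)
    obtain c v t d where n: "n = Mon c v t d" by (cases n)
    let ?P = "foldl (\<lambda>P (k, v). P ** wmat k ** \<rho> v) (wmat a ** \<rho> u) s"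
    let ?Q = "foldl (\<lambda>P (k, v). P ** wmat k ** \<rho> v) (\<rho> v) t ** wmat d"
    have "eval_at \<rho> (fmult (fmono m) (fmono n)) = ?P ** (wmat b ** wmat c) ** ?Q"
      unfolding m n fmult_Mon by (intro eval_wsum) (simp_all add: UT2_mult foldl_mon_eval matrix_mul_assoc)
    then show ?case
      unfolding m n eval_fmono mon_eval_left[of \<rho> c] by (simp add: matrix_mul_assoc)
  qed (simp_all add: act_add act_scale eval_add eval_scale mult_add_right smat_mult_right)
qed (simp_all add: act_add act_scale eval_add eval_scale mult_add_left smat_mult_left)

definition admissible :: "(var \<Rightarrow> 'f::field^2^2) \<Rightarrow> bool" where
  "admissible \<rho> \<longleftrightarrow> (\<forall>u. \<rho> u \<in> UT2_component (vdeg u))"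

lemma Id_UT2_iff: "f \<in> Id_UT2 \<longleftrightarrow> (\<forall>\<rho>. admissible \<rho> \<longrightarrow> eval_at \<rho> f = 0)"
  by (simp add: Id_UT2_def admissible_def)

lemma mem_UT2_component:
  "A \<in> UT2_component d \<longleftrightarrow> A $ 2 $ 1 = 0 \<and> (if d = 0 then A $ 1 $ 2 = 0 else A $ 1 $ 1 = 0 \<and> A $ 2 $ 2 = 0)"
proof (cases "d = 0")
  case True
  have "A = smat (A $ 1 $ 1) e11 + smat (A $ 2 $ 2) e22" if "A $ 2 $ 1 = 0" "A $ 1 $ 2 = 0"
    using that by (simp add: vec_eq_iff forall_2 smat_def e11_def e22_def)
  with True show ?thesis
    by (auto simp: UT2_component_def) (auto simp: smat_def e11_def e22_def)
next
  case False
  have "A = smat (A $ 1 $ 2) e12" if "A $ 2 $ 1 = 0" "A $ 1 $ 1 = 0" "A $ 2 $ 2 = 0"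
    using that by (simp add: vec_eq_iff forall_2 smat_def e12_def)
  with False show ?thesis
    by (auto simp: UT2_component_def) (auto simp: smat_def e12_def)
qed

lemma Z2_cases: "(d :: 2) = 0 \<or> d = 1"
  using exhaust_2[of d] by auto

lemma UT2_component_mult:
  assumes "A \<in> UT2_component d" "B \<in> UT2_component e"
  shows "A ** B \<in> UT2_component (d + e)"
  using Z2_cases[of d] Z2_cases[of e] assms by (auto simp: mem_UT2_component mat2_mult)

lemma wmat_component: "wmat k \<in> UT2_component (wdeg k)"
  by (cases k) (auto simp: mem_UT2_component e11_def e12_def e22_def)

lemma mon_eval_component:
  assumes "admissible \<rho>"
  shows "mon_eval \<rho> m \<in> UT2_component (mdeg m)"
proof (cases m)
  case (Mon a u s b)
  have \<rho>: "\<rho> v \<in> UT2_component (vdeg v)" for v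
    using assms by (simp add: admissible_def)
  have "foldl (\<lambda>P (k, v). P ** wmat k ** \<rho> v) A s \<in>
      UT2_component (d + (\<Sum>(k, v)\<leftarrow>s. wdeg k + vdeg v))" if "A \<in> UT2_component d" for A d
    using that
  proof (induction s arbitrary: A d)
    case (Cons p s)
    obtain k v where p: "p = (k, v)" by fastforce
    have "A ** wmat k ** \<rho> v \<in> UT2_component (d + wdeg k + vdeg v)"
      using Cons.prems by (intro UT2_component_mult wmat_component \<rho>)
    from Cons.IH[OF this] show ?case by (simp add: p add_ac)
  qed simp
  from UT2_component_mult[OF this[OF UT2_component_mult[OF wmat_component \<rho>]] wmat_component]
  show ?thesis by (simp add: Mon del: wmat.simps)
qed

lemma eval_component:
  assumes "admissible \<rho>" "f \<in> free_component d"
  shows "eval_at \<rho> f \<in> UT2_component d"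
  using assms(2) unfolding free_component_def
proof (induction rule: free.span_induct)
  case base
  show ?case
    by (auto simp: free.subspace_def eval_add eval_scale mem_UT2_component smat_def)
next
  case (step f)
  then show ?case using mon_eval_component[OF assms(1)] by auto
qed

text \<open>
  An endomorphism amounts to a substitution: evaluating after it is the same as evaluating at the
  values of the images of the variables.
\<close>

lemma eval_endo:
  assumes \<phi>: "graded_W_endo \<phi>" and \<rho>: "admissible \<rho>"
  obtains \<rho>' where "admissible \<rho>'" "\<And>f. eval_at \<rho> (\<phi> f) = eval_at \<rho>' f"
proof
  let ?\<rho>' = "\<lambda>u. eval_at \<rho> (\<phi> (fvar u))"
  have hom: "\<phi> (f + g) = \<phi> f + \<phi> g" "\<phi> (fscale c f) = fscale c (\<phi> f)"
    "\<phi> (fmult f g) = fmult (\<phi> f) (\<phi> g)" for c f g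
    using \<phi> unfolding graded_W_endo_def by blast+
  have act: "\<phi> (lact A f) = lact A (\<phi> f)" "\<phi> (ract f A) = ract (\<phi> f) A" if "A \<in> UT2" for A f
    using \<phi> that unfolding graded_W_endo_def by blast+
  have deg: "f \<in> free_component d \<Longrightarrow> \<phi> f \<in> free_component d" for f d
    using \<phi> unfolding graded_W_endo_def by blast
  have "fvar u \<in> free_component (vdeg u)" for u :: var
    by (auto simp: fvar_def free_component_def intro!: free.span_base)
  then show "admissible ?\<rho>'"
    unfolding admissible_def using eval_component[OF \<rho>] deg by blast
  have mono: "eval_at \<rho> (\<phi> (fmono m)) = mon_eval ?\<rho>' m" for m
  proof (induction m rule: monom_induct)
    case (start a u)
    show ?case by (simp add: fmono_start act eval_lact wmat_one del: wmat.simps)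
  next
    case (ract a u s b)
    then show ?case
      by (subst fmono_ract) (simp add: act eval_ract wmat_one del: wmat.simps)
  next
    case (snoc a u s w v)
    then show ?case
      by (subst fmono_snoc) (simp add: hom eval_fmult wmat_one del: wmat.simps)
  qed
  have "\<phi> 0 = 0" using hom(2)[of 0 0] by simp
  then show "eval_at \<rho> (\<phi> f) = eval_at ?\<rho>' f" for f
    by (induction f rule: free_induct) (simp_all add: hom mono eval_add eval_scale)
qed

lemma TW_ideal_Id_UT2: "TW_ideal (Id_UT2 :: 'f::field free_walg set)"
  unfolding TW_ideal_def
proof (intro conjI ballI allI impI)
  show "free.subspace (Id_UT2 :: 'f free_walg set)"
    by (auto simp: free.subspace_def Id_UT2_iff eval_add eval_scale smat_def vec_eq_iff)
next
  fix \<phi> :: "'f free_walg \<Rightarrow> 'f free_walg"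
  assume \<phi>: "graded_W_endo \<phi>"
  show "\<phi> ` Id_UT2 \<subseteq> Id_UT2"
  proof safe
    fix f :: "'f free_walg"
    assume f: "f \<in> Id_UT2"
    have "eval_at \<rho> (\<phi> f) = 0" if "admissible \<rho>" for \<rho>
      using eval_endo[OF \<phi> that] f by (metis Id_UT2_iff)
    then show "\<phi> f \<in> Id_UT2" by (simp add: Id_UT2_iff)
  qed
qed (auto simp: Id_UT2_iff eval_fmult eval_lact eval_ract)

lemma generators_in_Id_UT2:
  "fcomm (fvar (Y 0)) (fvar (Y 1)) \<in> (Id_UT2 :: 'f::field free_walg set)"
  "lact e22 (fvar (Y 0)) - ract (fvar (Y 0)) e22 \<in> (Id_UT2 :: 'f free_walg set)"
  "ract (fvar (Z 0)) e22 - fvar (Z 0) \<in> (Id_UT2 :: 'f free_walg set)"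
  "lact e22 (fvar (Z 0)) \<in> (Id_UT2 :: 'f free_walg set)"
proof -
  have var: "eval_at \<rho> (fvar v) = \<rho> v" for \<rho> :: "var \<Rightarrow> 'f^2^2" and v
    by (simp add: fvar_def wmat_one[simplified])
  have e22: "e22 $ 1 $ 1 = (0 :: 'f)" "e22 $ 1 $ 2 = (0 :: 'f)" "e22 $ 2 $ 1 = (0 :: 'f)"
    "e22 $ 2 $ 2 = (1 :: 'f)"
    by (simp_all add: e22_def)
  have Y: "\<rho> (Y i) $ 1 $ 2 = 0 \<and> \<rho> (Y i) $ 2 $ 1 = 0"
    and Z: "\<rho> (Z i) $ 1 $ 1 = 0 \<and> \<rho> (Z i) $ 2 $ 1 = 0 \<and> \<rho> (Z i) $ 2 $ 2 = 0"
    if "admissible \<rho>" for \<rho> :: "var \<Rightarrow> 'f^2^2" and i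
    using that[unfolded admissible_def, rule_format, of "Y i"]
      that[unfolded admissible_def, rule_format, of "Z i"] by (auto simp: mem_UT2_component)
  show "fcomm (fvar (Y 0)) (fvar (Y 1)) \<in> (Id_UT2 :: 'f free_walg set)"
    "lact e22 (fvar (Y 0)) - ract (fvar (Y 0)) e22 \<in> (Id_UT2 :: 'f free_walg set)"
    "ract (fvar (Z 0)) e22 - fvar (Z 0) \<in> (Id_UT2 :: 'f free_walg set)"
    "lact e22 (fvar (Z 0)) \<in> (Id_UT2 :: 'f free_walg set)"
    by (auto simp: Id_UT2_iff fcomm_def eval_minus eval_fmult eval_lact eval_ract var vec_eq_iff
        forall_2 mat2_mult e22 Y Z)
qed


section \<open>Independence of the normal forms\<close>

text \<open>
  The functions \<open>h \<mapsto> \<Prod>x\<in>#M. h x\<close> are distinct multiplicative characters, and the proof is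
  Dedekind's: to isolate the coefficient of one monomial, double a variable \<open>x\<close> whose exponent in
  another monomial is different, and subtract a multiple of the original relation so that one term
  drops out. Characteristic zero ensures that different powers of 2 are different in the field.
\<close>

lemma monomial_functions_independent:
  fixes c :: "'s \<Rightarrow> 'f::field_char_0" and g :: "'s \<Rightarrow> 'x multiset"
  assumes "finite S" "inj_on g S" "\<And>h. (\<Sum>s\<in>S. c s * (\<Prod>x\<in>#g s. h x)) = 0" "s \<in> S"
  shows "c s = 0"
  using assms
proof (induction "card S" arbitrary: S c s rule: less_induct)
  case less
  note vanish = less.prems(3)
  have other: "c t = 0" if t: "t \<in> S" "t \<noteq> s" for t
  proof -
    from t less.prems have "g s \<noteq> g t" by (auto dest: inj_onD)
    then obtain x where x: "count (g s) x \<noteq> count (g t) x" by (auto simp: multiset_eq_iff)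
    \<comment> \<open>Doubling \<open>x\<close> multiplies the term of \<open>r\<close> by \<open>2 ^ count (g r) x\<close>; subtracting the relation
      scaled by the factor of \<open>s\<close> removes the term of \<open>s\<close>.\<close>
    define c' where "c' r = c r * (2 ^ count (g r) x - 2 ^ count (g s) x)" for r
    have scaled: "(\<Prod>y\<in>#M. if y = x then 2 * h y else h y) = 2 ^ count M x * (\<Prod>y\<in>#M. h y)"
      for M :: "'x multiset" and h :: "'x \<Rightarrow> 'f"
      by (induction M) auto
    have "(\<Sum>r\<in>S - {s}. c' r * (\<Prod>y\<in>#g r. h y)) = 0" for h
    proof -
      have "(\<Sum>r\<in>S - {s}. c' r * (\<Prod>y\<in>#g r. h y)) = (\<Sum>r\<in>S. c' r * (\<Prod>y\<in>#g r. h y))"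
        using less.prems(1) by (intro sum.mono_neutral_left) (auto simp: c'_def)
      also have "\<dots> = (\<Sum>r\<in>S. c r * (\<Prod>y\<in>#g r. if y = x then 2 * h y else h y)) -
          2 ^ count (g s) x * (\<Sum>r\<in>S. c r * (\<Prod>y\<in>#g r. h y))"
        by (simp add: c'_def scaled sum_distrib_left sum_subtractf[symmetric] algebra_simps)
      finally show ?thesis using vanish by simp
    qed
    moreover have "card (S - {s}) < card S"
      using less.prems(1,4) by (rule card_Diff1_less)
    ultimately have "c' t = 0"
      using less.prems(1,2) t by (intro less.hyps[of "S - {s}" c' t]) (auto intro: inj_on_diff)
    moreover have "(2 :: 'f) ^ count (g t) x \<noteq> 2 ^ count (g s) x"
    proof
      assume "(2 :: 'f) ^ count (g t) x = 2 ^ count (g s) x"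
      then have "of_nat (2 ^ count (g t) x) = (of_nat (2 ^ count (g s) x) :: 'f)" by simp
      with x show False by (simp only: of_nat_eq_iff) simp
    qed
    ultimately show ?thesis by (simp add: c'_def)
  qed
  have "(\<Sum>r\<in>S. c r) = c s"
    using less.prems(1,4) other by (subst sum.remove) auto
  then show ?case using vanish[of "\<lambda>_. 1"] by simp
qed

text \<open>
  The coordinates of a generic substitution: \<open>y\<^sub>i\<close> becomes the diagonal matrix with entries \<open>D1 i\<close>
  and \<open>D2 i\<close>, and \<open>z\<^sub>k\<close> becomes \<open>U k\<close> times \<open>e12\<close>.
\<close>

datatype slot = D1 nat | D2 nat | U nat

definition up_slots :: "nat multiset \<Rightarrow> nat option \<Rightarrow> nat multiset \<Rightarrow> slot multiset" where
  "up_slots M c N =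
     image_mset D1 M + (case c of None \<Rightarrow> {#} | Some k \<Rightarrow> {#U k#}) + image_mset D2 N"

lemma up_slots_inject: "up_slots M c N = up_slots M' c' N' \<longleftrightarrow> M = M' \<and> c = c' \<and> N = N'"
proof -
  have 1: "count (up_slots M c N) (D1 i) = count M i"
    and 2: "count (up_slots M c N) (D2 i) = count N i"
    and 3: "count (up_slots M c N) (U i) = (if c = Some i then 1 else 0)" for M c N i
  proof -
    have "count (image_mset D1 M) (D1 i) = count M i" "count (image_mset D1 M) (D2 i) = 0"
      "count (image_mset D1 M) (U i) = 0" "count (image_mset D2 N) (D2 i) = count N i"
      "count (image_mset D2 N) (D1 i) = 0" "count (image_mset D2 N) (U i) = 0"
      by (induction M) (auto, (induction N, auto)+)
    then show "count (up_slots M c N) (D1 i) = count M i"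
      "count (up_slots M c N) (D2 i) = count N i"
      "count (up_slots M c N) (U i) = (if c = Some i then 1 else 0)"
      by (auto simp: up_slots_def split: option.split)
  qed
  have "c = c'" if "up_slots M c N = up_slots M' c' N'"
    using that 3[of M c N] 3[of M' c' N'] by (cases c; cases c') (auto, metis zero_neq_one, metis zero_neq_one, metis zero_neq_one)
  moreover have "M = M' \<and> N = N'" if "up_slots M c N = up_slots M' c' N'"
    using that 1[of M c N] 1[of M' c' N'] 2[of M c N] 2[of M' c' N'] by (simp add: multiset_eq_iff)
  ultimately show ?thesis by blast
qed

text \<open>
  The value of a normal form at the generic substitution has, in the positions \<open>(1, 1)\<close>, \<open>(2, 2)\<close>
  and \<open>(1, 2)\<close>, a monomial in the coordinates (\<open>Some\<close>) or zero (\<open>None\<close>).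
\<close>

fun entries :: "nform \<Rightarrow> slot multiset option \<times> slot multiset option \<times> slot multiset option" where
  "entries NZero = (None, None, None)"
| "entries (NDiag M) = (Some (image_mset D1 M), Some (image_mset D2 M), None)"
| "entries (NLow M) = (None, Some (image_mset D2 M), None)"
| "entries (NUp M c N) = (None, None, Some (up_slots M c N))"

definition entry_val :: "(slot \<Rightarrow> 'f::field) \<Rightarrow> slot multiset option \<Rightarrow> 'f" where
  "entry_val h e = (case e of None \<Rightarrow> 0 | Some M \<Rightarrow> \<Prod>x\<in>#M. h x)"

definition nform_val :: "(slot \<Rightarrow> 'f::field) \<Rightarrow> nform \<Rightarrow> 'f^2^2" where
  "nform_val h s = (case entries s of (a, b, c) \<Rightarrow>
     smat (entry_val h a) e11 + smat (entry_val h b) e22 + smat (entry_val h c) e12)"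

fun generic :: "(slot \<Rightarrow> 'f::field) \<Rightarrow> var \<Rightarrow> 'f^2^2" where
  "generic h (Y i) = smat (h (D1 i)) e11 + smat (h (D2 i)) e22"
| "generic h (Z k) = smat (h (U k)) e12"

lemma admissible_generic: "admissible (generic h)"
  unfolding admissible_def
proof
  fix u show "generic h u \<in> UT2_component (vdeg u)"
    by (cases u) (auto simp: mem_UT2_component smat_def e11_def e12_def e22_def)
qed

lemma nform_val_step_w: "nform_val h (step_w s w) = nform_val h s ** wmat w"
  by (cases s; cases w)
     (simp_all add: nform_val_def entry_val_def up_slots_def vec_eq_iff forall_2 mat2_mult smat_def
       e11_def e12_def e22_def)

lemma nform_val_step_v: "nform_val h (step_v s v) = nform_val h s ** generic h v"
  by (cases s; cases v)
     (simp_all add: nform_val_def entry_val_def up_slots_def vec_eq_iff forall_2 mat2_mult smat_def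
       e11_def e12_def e22_def)

lemma mon_eval_generic: "mon_eval (generic h) m = nform_val h (nf m)"
proof (cases m)
  case (Mon a u s b)
  have one: "nform_val h (NDiag {#}) = mat 1"
    by (simp add: nform_val_def entry_val_def vec_eq_iff forall_2 smat_def mat_def e11_def e12_def e22_def)
  have "foldl (\<lambda>P (k, v). P ** wmat k ** generic h v) (nform_val h t) s =
      nform_val h (foldl (\<lambda>t (k, v). step_v (step_w t k) v) t s)" for t
    by (induction s arbitrary: t) (auto simp: nform_val_step_v[symmetric] nform_val_step_w[symmetric] simp del: wmat.simps generic.simps)
  from this[of "step_v (step_w (NDiag {#}) a) u"] show ?thesis
    by (simp add: Mon one nform_val_step_v nform_val_step_w del: wmat.simps generic.simps)
qed

text \<open>
  The three entries are treated in turn. Position \<open>(1, 1)\<close> only sees the forms \<open>NDiag M\<close>, with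
  different monomials for different \<open>M\<close>, so their coefficients vanish. Position \<open>(2, 2)\<close> does not
  distinguish \<open>NDiag M\<close> from \<open>NLow M\<close>, but the former have already disappeared. Position \<open>(1, 2)\<close>
  only sees the forms \<open>NUp M c N\<close>, again with different monomials.
\<close>

lemma nform_val_independent:
  fixes c :: "nform \<Rightarrow> 'f::field_char_0"
  assumes S: "finite S" and vanish: "\<And>h. (\<Sum>s\<in>S. smat (c s) (nform_val h s)) = 0"
    and s: "s \<in> S" "s \<noteq> NZero"
  shows "c s = 0"
proof -
  have entry: "c t = 0" if e: "\<And>h. (\<Sum>s\<in>S. c s * entry_val h (e s)) = 0"
    and T: "T \<subseteq> S" "inj_on (the \<circ> e) T" "\<And>s. s \<in> T \<Longrightarrow> e s \<noteq> None"
      "\<And>s. s \<in> S - T \<Longrightarrow> e s = None \<or> c s = 0"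
    and t: "t \<in> T" for e T t
  proof (rule monomial_functions_independent[of T "the \<circ> e"])
    fix h
    have "(\<Sum>s\<in>T. c s * (\<Prod>x\<in>#(the \<circ> e) s. h x)) = (\<Sum>s\<in>T. c s * entry_val h (e s))"
    proof (rule sum.cong)
      fix s assume "s \<in> T"
      with T(3)[of s] show "c s * (\<Prod>x\<in>#(the \<circ> e) s. h x) = c s * entry_val h (e s)"
        by (auto simp: entry_val_def)
    qed simp
    also have "\<dots> = (\<Sum>s\<in>S. c s * entry_val h (e s))"
    proof (intro sum.mono_neutral_left ballI)
      fix s assume "s \<in> S - T"
      from T(4)[OF this] show "c s * entry_val h (e s) = 0" by (auto simp: entry_val_def)
    qed (use S T(1) in auto)
    finally show "(\<Sum>s\<in>T. c s * (\<Prod>x\<in>#(the \<circ> e) s. h x)) = 0" using e by simp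
  qed (use S T t in \<open>auto intro: finite_subset\<close>)
  have "(\<Sum>s\<in>S. smat (c s) (nform_val h s)) $ i $ j = 0" for h i j
    using vanish[of h] by simp
  then have vanish': "(\<Sum>s\<in>S. c s * nform_val h s $ i $ j) = 0" for h i j
    by (simp add: smat_def)
  have nform_val: "nform_val h s $ 1 $ 1 = entry_val h (fst (entries s))"
    "nform_val h s $ 2 $ 2 = entry_val h (fst (snd (entries s)))"
    "nform_val h s $ 1 $ 2 = entry_val h (snd (snd (entries s)))" for h :: "slot \<Rightarrow> 'f" and s
    by (auto simp: nform_val_def smat_def e11_def e12_def e22_def split: prod.split)
  have inj: "inj D1" "inj D2" by (auto simp: inj_def)
  have D: "c (NDiag M) = 0" if "NDiag M \<in> S" for M
  proof (rule entry[of "fst \<circ> entries" "S \<inter> range NDiag"])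
    show "inj_on (the \<circ> (fst \<circ> entries)) (S \<inter> range NDiag)"
      using inj by (auto simp: inj_on_def inj_eq[OF multiset.inj_map[OF inj(1)]])
    show "(fst \<circ> entries) s = None \<or> c s = 0" if "s \<in> S - S \<inter> range NDiag" for s
      using that by (cases s) auto
  qed (use that vanish'[of _ 1 1] in \<open>auto simp: nform_val\<close>)
  have L: "c (NLow M) = 0" if "NLow M \<in> S" for M
  proof (rule entry[of "fst \<circ> snd \<circ> entries" "S \<inter> range NLow"])
    show "inj_on (the \<circ> (fst \<circ> snd \<circ> entries)) (S \<inter> range NLow)"
      using inj by (auto simp: inj_on_def inj_eq[OF multiset.inj_map[OF inj(2)]])
    show "(fst \<circ> snd \<circ> entries) s = None \<or> c s = 0" if "s \<in> S - S \<inter> range NLow" for s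
      using that D by (cases s) auto
  qed (use that vanish'[of _ 2 2] in \<open>auto simp: nform_val\<close>)
  have U: "c (NUp M k N) = 0" if "NUp M k N \<in> S" for M k N
  proof (rule entry[of "snd \<circ> snd \<circ> entries" "S \<inter> {NUp M k N | M k N. True}"])
    show "inj_on (the \<circ> (snd \<circ> snd \<circ> entries)) (S \<inter> {NUp M k N | M k N. True})"
      by (auto simp: inj_on_def up_slots_inject)
    show "(snd \<circ> snd \<circ> entries) s = None \<or> c s = 0"
      if "s \<in> S - S \<inter> {NUp M k N | M k N. True}" for s
      using that by (cases s) auto
  qed (use that vanish'[of _ 1 2] in \<open>auto simp: nform_val\<close>)
  from s D L U show ?thesis by (cases s) auto
qed

lemma Id_UT2_coefficients:
  fixes f :: "'f::field_char_0 free_walg"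
  assumes "f \<in> Id_UT2" "s \<noteq> NZero"
  shows "nf_coeff s f = 0"
proof (cases "s \<in> nf ` Poly_Mapping.keys f")
  case True
  interpret smat: vector_space smat by (rule vector_space_smat)
  let ?K = "Poly_Mapping.keys f" and ?c = "Poly_Mapping.lookup f"
  show ?thesis
  proof (rule nform_val_independent[of "nf ` ?K" "\<lambda>s. nf_coeff s f"])
    fix h
    have "0 = (\<Sum>m\<in>?K. smat (?c m) (nform_val h (nf m)))"
      using assms(1) admissible_generic[of h]
      by (auto simp: Id_UT2_iff eval_at_def mon_eval_generic)
    also have "\<dots> = (\<Sum>s\<in>nf ` ?K. \<Sum>m\<in>{m \<in> ?K. nf m = s}. smat (?c m) (nform_val h (nf m)))"
      by (rule sum.image_gen) simp
    also have "\<dots> = (\<Sum>s\<in>nf ` ?K. smat (nf_coeff s f) (nform_val h s))"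
      by (simp add: nf_coeff_eq smat.scale_sum_left)
    finally show "(\<Sum>s\<in>nf ` ?K. smat (nf_coeff s f) (nform_val h s)) = 0" ..
  qed (use True assms(2) in auto)
next
  case False
  then have "{m \<in> Poly_Mapping.keys f. nf m = s} = {}" by auto
  then show ?thesis by (simp only: nf_coeff_eq sum.empty)
qed

text \<open>
  The ideal of identities contains the relations. Conversely, an identity has vanishing coefficients
  at all normal forms and hence lies in every ideal containing the relations.
\<close>

theorem Id_UT2_generated:
  "(Id_UT2 :: 'f::field_char_0 free_walg set) =
     TW_ideal_gen
       {fcomm (fvar (Y 0)) (fvar (Y 1)),
        lact e22 (fvar (Y 0)) - ract (fvar (Y 0)) e22,
        ract (fvar (Z 0)) e22 - fvar (Z 0),
        lact e22 (fvar (Z 0))}"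
  (is "_ = TW_ideal_gen ?S")
proof
  show "TW_ideal_gen ?S \<subseteq> (Id_UT2 :: 'f free_walg set)"
    using TW_ideal_Id_UT2 generators_in_Id_UT2 by (auto simp: TW_ideal_gen_def)
  have "f \<in> J" if "f \<in> (Id_UT2 :: 'f free_walg set)" "TW_ideal J" "?S \<subseteq> J" for f J
  proof -
    interpret relation_ideal J
      using that by unfold_locales auto
    show "f \<in> J"
      using Id_UT2_coefficients[OF that(1)] by (rule mem_ideal)
  qed
  then show "(Id_UT2 :: 'f free_walg set) \<subseteq> TW_ideal_gen ?S"
    unfolding TW_ideal_gen_def by blast
qed

text \<open>
  The ideal of identities is itself an ideal containing the relations, so the reduction applies to it
  and the vanishing of the coefficients is also sufficient. Thus the nonzero normal forms are a basis
  of the free algebra modulo the identities.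
\<close>

lemma mem_Id_UT2_iff:
  "f \<in> (Id_UT2 :: 'f::field_char_0 free_walg set) \<longleftrightarrow> (\<forall>s. s \<noteq> NZero \<longrightarrow> nf_coeff s f = 0)"
proof
  interpret relation_ideal "Id_UT2 :: 'f free_walg set"
    by unfold_locales (rule TW_ideal_Id_UT2 generators_in_Id_UT2)+
  show "\<forall>s. s \<noteq> NZero \<longrightarrow> nf_coeff s f = 0 \<Longrightarrow> f \<in> Id_UT2"
    by (rule mem_ideal) blast
qed (use Id_UT2_coefficients in blast)


section \<open>Dimension of a quotient space\<close>

text \<open>
  A finite family in \<open>V\<close> that is a basis modulo \<open>U\<close>, in the sense of \<open>gen\<close> and \<open>ind\<close>, computes the
  dimension of \<open>V / U\<close>: its cosets are pairwise distinct and form a basis.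
\<close>

lemma dim_quotient_space:
  fixes sc :: "'f::field \<Rightarrow> 'v::ab_group_add \<Rightarrow> 'v" and V U :: "'v set" and r :: "'s \<Rightarrow> 'v"
  assumes sc: "vector_space sc"
    and sub: "Modules.module.subspace sc V" "Modules.module.subspace sc U" "U \<subseteq> V"
    and S: "finite S" "r ` S \<subseteq> V"
    and gen: "\<And>v. v \<in> V \<Longrightarrow> \<exists>c. v - (\<Sum>s\<in>S. sc (c s) (r s)) \<in> U"
    and ind: "\<And>c s. (\<Sum>s\<in>S. sc (c s) (r s)) \<in> U \<Longrightarrow> s \<in> S \<Longrightarrow> c s = 0"
  shows "vectorspace.dim scalar_ring (quotient_space sc V U) = card S"
proof -
  interpret sc: vector_space sc by fact
  interpret Q: vectorspace scalar_ring "quotient_space sc V U"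
    by (rule vectorspace_quotient_space) fact+
  note V = sc.subspace_0[OF sub(1)] sc.subspace_add[OF sub(1)] sc.subspace_scale[OF sub(1)]
  note U = sc.subspace_0[OF sub(2)] sc.subspace_add[OF sub(2)] sc.subspace_scale[OF sub(2)]
    sc.subspace_diff[OF sub(2)]
  let ?Q = "quotient_space sc V U"
  define co where "co v = {v + x | x. x \<in> U}" for v
  have mem: "y \<in> co v \<longleftrightarrow> y - v \<in> U" for y v
    by (auto simp: co_def intro!: exI[of _ "y - v"])
  have co_eq: "co v = co w \<longleftrightarrow> v - w \<in> U" for v w
  proof
    assume "co v = co w"
    then have "v \<in> co w" using U(1) mem[of v v] by simp
    then show "v - w \<in> U" by (simp add: mem)
  next
    assume vw: "v - w \<in> U"
    have "y - v \<in> U \<longleftrightarrow> y - w \<in> U" for y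
      using U(2)[of "y - v" "v - w"] U(4)[of "y - w" "v - w"] vw by auto
    then show "co v = co w" by (auto simp: mem)
  qed
  have carr: "carrier ?Q = co ` V" and zero: "\<zero>\<^bsub>?Q\<^esub> = co 0"
    by (simp_all add: quotient_space_def co_def)
  have add: "co v \<oplus>\<^bsub>?Q\<^esub> co w = co (v + w)" for v w
  proof -
    have "\<exists>a b. y = a + b \<and> a - v \<in> U \<and> b - w \<in> U" if "y - (v + w) \<in> U" for y
      using that U(1) by (intro exI[of _ "y - w"] exI[of _ w]) (simp add: algebra_simps)
    moreover have "(a + b) - (v + w) \<in> U" if "a - v \<in> U" "b - w \<in> U" for a b
      using U(2)[OF that] by (simp add: algebra_simps)
    ultimately show ?thesis by (auto simp: quotient_space_def mem)
  qed
  have smult: "c \<odot>\<^bsub>?Q\<^esub> co v = co (sc c v)" for c v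
  proof -
    have "\<exists>a x. y = sc c a + x \<and> a - v \<in> U \<and> x \<in> U" if "y - sc c v \<in> U" for y
      using that U(1) by (intro exI[of _ v] exI[of _ "y - sc c v"]) simp
    moreover have "(sc c a + x) - sc c v \<in> U" if "a - v \<in> U" "x \<in> U" for a x
      using U(2)[OF U(3)[OF that(1), of c] that(2)]
      by (simp add: sc.scale_right_diff_distrib algebra_simps)
    ultimately show ?thesis by (auto simp: quotient_space_def mem)
  qed
  have K: "carrier scalar_ring = (UNIV :: 'f set)" "\<zero>\<^bsub>scalar_ring\<^esub> = (0 :: 'f)"
    by (simp_all add: scalar_ring_def)
  let ?B = "(\<lambda>s. co (r s)) ` S"
  have inj: "inj_on (\<lambda>s. co (r s)) S"
  proof (rule inj_onI, rule ccontr)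
    fix s t assume st: "s \<in> S" "t \<in> S" "co (r s) = co (r t)" "s \<noteq> t"
    \<comment> \<open>If two cosets coincided, \<open>r s - r t\<close> would be a nontrivial relation modulo \<open>U\<close>.\<close>
    let ?c = "\<lambda>u. if u = s then 1 else if u = t then -1 else 0 :: 'f"
    have "(\<Sum>u\<in>S. sc (?c u) (r u)) = (\<Sum>u\<in>{s, t}. sc (?c u) (r u))"
      using S(1) st by (intro sum.mono_neutral_right) auto
    also have "\<dots> = r s - r t" using st(4) by simp
    finally show False using ind[of ?c s] st co_eq by simp
  qed
  have rV: "r s \<in> V" if "s \<in> S" for s using that S(2) by auto
  have B: "finite ?B" "?B \<subseteq> carrier ?Q" using S(1) rV by (auto simp: carr)
  have lincomb: "Q.lincomb a ((\<lambda>s. co (r s)) ` T) = co (\<Sum>s\<in>T. sc (a (co (r s))) (r s))"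
    if "finite T" "T \<subseteq> S" for a T
    using that
  proof (induction T)
    case empty
    show ?case by (simp add: Q.lincomb_def zero)
  next
    case (insert t T)
    then have "co (r t) \<notin> (\<lambda>s. co (r s)) ` T"
      using inj by (auto simp: inj_on_def)
    then have "Q.lincomb a ((\<lambda>s. co (r s)) ` T \<union> {co (r t)}) =
        a (co (r t)) \<odot>\<^bsub>?Q\<^esub> co (r t) \<oplus>\<^bsub>?Q\<^esub> Q.lincomb a ((\<lambda>s. co (r s)) ` T)"
      using insert rV by (intro Q.lincomb_insert) (auto simp: carr K)
    with insert show ?case by (simp add: add smult)
  qed
  have "Q.basis ?B"
    unfolding Q.basis_def
  proof (intro conjI B(2))
    show "Q.lin_indpt ?B"
    proof (rule Q.finite_lin_indpt2[OF B])
      fix a assume "Q.lincomb a ?B = \<zero>\<^bsub>?Q\<^esub>"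
      then have "(\<Sum>s\<in>S. sc (a (co (r s))) (r s)) \<in> U"
        using lincomb[OF S(1) subset_refl, of a] co_eq[of _ 0] by (simp add: zero)
      then show "\<forall>v\<in>?B. a v = \<zero>\<^bsub>scalar_ring\<^esub>"
        using ind[of "\<lambda>s. a (co (r s))"] by (auto simp: K)
    qed
    have "co v \<in> Q.span ?B" if v: "v \<in> V" for v
    proof -
      obtain c where c: "v - (\<Sum>s\<in>S. sc (c s) (r s)) \<in> U" using gen[OF v] by blast
      let ?a = "\<lambda>X. c (inv_into S (\<lambda>s. co (r s)) X)"
      have "Q.lincomb ?a ?B = co (\<Sum>s\<in>S. sc (c s) (r s))"
        using lincomb[OF S(1) subset_refl, of ?a] by (simp add: inv_into_f_f[OF inj])
      with c have "co v = Q.lincomb ?a ?B" by (simp add: co_eq)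
      then show ?thesis unfolding Q.finite_span[OF B] by (auto simp: K)
    qed
    then show "Q.span ?B = carrier ?Q"
      using Q.span_is_subset2[OF B(2)] by (auto simp: carr)
  qed
  from Q.dim_basis[OF B(1) this] show ?thesis by (simp add: card_image[OF inj])
qed

section \<open>Multilinear normal forms\<close>

fun var_index :: "var \<Rightarrow> nat" where
  "var_index (Y i) = i"
| "var_index (Z i) = i"

fun monom_vars :: "monom \<Rightarrow> var list" where
  "monom_vars (Mon a u s b) = u # map snd s"

text \<open>
  The indices of the variables of a monomial survive the reduction unless it ends in zero. So the
  normal forms of multilinear monomials are exactly those of content \<open>{0, \<dots>, n - 1}\<close>, and these are
  easy to count.
\<close>

fun nf_content :: "nform \<Rightarrow> nat multiset" where
  "nf_content NZero = {#}"
| "nf_content (NDiag M) = M"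
| "nf_content (NLow M) = M"
| "nf_content (NUp M c N) = M + (case c of None \<Rightarrow> {#} | Some k \<Rightarrow> {#k#}) + N"

lemma nf_content_step_w: "step_w s w \<noteq> NZero \<Longrightarrow> nf_content (step_w s w) = nf_content s"
  by (cases s; cases w) auto

lemma nf_content_step_v:
  "step_v s v \<noteq> NZero \<Longrightarrow> nf_content (step_v s v) = add_mset (var_index v) (nf_content s)"
  by (cases s; cases v) auto

lemma step_NZero [simp]: "step_w NZero w = NZero" "step_v NZero v = NZero"
  by (cases w; simp) (cases v; simp)

lemma nf_content_nf: "nf m \<noteq> NZero \<Longrightarrow> nf_content (nf m) = image_mset var_index (mset (monom_vars m))"
proof (induction m rule: monom_induct)
  case (start a u)
  then have "step_w (NDiag {#}) a \<noteq> NZero" by auto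
  with start show ?case
    using nf_content_step_v[of "step_w (NDiag {#}) a" u] nf_content_step_w[of "NDiag {#}" a] by simp
next
  case (ract a u s b)
  then have "nf (Mon a u s W_one) \<noteq> NZero" by (metis nf_ract step_NZero(1))
  with ract show ?case
    using nf_content_step_w[of "nf (Mon a u s W_one)" b]
    unfolding nf_ract[of a u s b] by (simp del: nf.simps)
next
  case (snoc a u s w v)
  then have "nf (Mon a u s w) \<noteq> NZero" by (metis nf_snoc step_NZero(2))
  with snoc show ?case
    using nf_content_step_v[of "nf (Mon a u s w)" v]
    unfolding nf_snoc by (simp del: nf.simps)
qed

text \<open>
  A monomial is multilinear when each index below \<open>n\<close> occurs in it exactly once; the permutation
  \<open>\<sigma>\<close> is then the sequence of indices, read from left to right.
\<close>

lemma multilinear_monoms_iff: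
  assumes "n \<ge> 1"
  shows "m \<in> multilinear_monoms n \<longleftrightarrow> image_mset var_index (mset (monom_vars m)) = mset_set {..<n}"
proof
  assume "m \<in> multilinear_monoms n"
  then obtain a b w u \<sigma> where m: "m = Mon a (u (\<sigma> 0)) (map (\<lambda>j. (w j, u (\<sigma> j))) [1..<n]) b"
    and \<sigma>: "\<sigma> permutes {..<n}" and u: "\<And>i. i < n \<Longrightarrow> u i \<in> {Y i, Z i}"
    unfolding multilinear_monoms_def by blast
  have idx: "var_index (u i) = i" if "i < n" for i using u[OF that] by auto
  have "monom_vars m = map (\<lambda>j. u (\<sigma> j)) (0 # [1..<n])" by (simp add: m)
  also have "0 # [1..<n] = [0..<n]" using assms by (simp add: upt_rec[of 0 n])
  finally have "map var_index (monom_vars m) = map \<sigma> [0..<n]"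
    using permutes_in_image[OF \<sigma>] by (simp add: idx)
  then have "image_mset var_index (mset (monom_vars m)) = image_mset \<sigma> (mset_set {..<n})"
    by (metis mset_map mset_upt atLeast0LessThan)
  also have "\<dots> = mset_set {..<n}"
    using \<sigma> by (simp add: image_mset_mset_set permutes_inj_on permutes_image)
  finally show "image_mset var_index (mset (monom_vars m)) = mset_set {..<n}" .
next
  assume *: "image_mset var_index (mset (monom_vars m)) = mset_set {..<n}"
  obtain a u0 s b where m: "m = Mon a u0 s b" by (cases m)
  define vs where "vs = monom_vars m"
  have mset: "mset (map var_index vs) = mset_set {..<n}" using * by (simp add: vs_def)
  have len: "length vs = n"
    using arg_cong[OF mset, of size] by simp
  then have lens: "length s = n - 1" by (simp add: vs_def m flip: len)
  have set: "set (map var_index vs) = {..<n}"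
    using arg_cong[OF mset, of set_mset] by simp
  have dist: "distinct (map var_index vs)"
    using set len by (intro card_distinct) simp
  define \<sigma> where "\<sigma> j = (if j < n then var_index (vs ! j) else j)" for j
  have "bij_betw (\<lambda>j. map var_index vs ! j) {..<n} {..<n}"
    by (rule bij_betw_nth) (use dist set len in auto)
  then have "bij_betw \<sigma> {..<n} {..<n}"
    by (rule bij_betw_cong[THEN iffD1, rotated]) (simp add: \<sigma>_def len)
  then have perm: "\<sigma> permutes {..<n}"
    by (rule bij_imp_permutes) (simp add: \<sigma>_def)
  define u where "u i = vs ! inv_into UNIV \<sigma> i" for i
  have u\<sigma>: "u (\<sigma> j) = vs ! j" for j
    using permutes_inverses(2)[OF perm] by (simp add: u_def)
  have "u i \<in> {Y i, Z i}" if "i < n" for i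
  proof -
    have "inv_into UNIV \<sigma> i < n"
      using that permutes_in_image[OF permutes_inv[OF perm], of i] by simp
    then have "var_index (u i) = \<sigma> (inv_into UNIV \<sigma> i)" by (simp add: u_def \<sigma>_def)
    also have "\<dots> = i" using permutes_inverses(1)[OF perm] by simp
    finally show ?thesis by (cases "u i") auto
  qed
  moreover have "u0 = u (\<sigma> 0)" by (simp add: u\<sigma> vs_def m)
  moreover have "s = map (\<lambda>j. (fst (s ! (j - 1)), u (\<sigma> j))) [1..<n]"
    by (rule nth_equalityI) (auto simp: lens u\<sigma> vs_def m)
  ultimately show "m \<in> multilinear_monoms n"
    unfolding multilinear_monoms_def m mem_Collect_eq using perm
    by (intro exI[of _ a] exI[of _ b] exI[of _ "\<lambda>j. fst (s ! (j - 1))"] exI[of _ u] exI[of _ \<sigma>]) auto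
qed

definition multilinear_nforms :: "nat \<Rightarrow> nform set" where
  "multilinear_nforms n = {s. s \<noteq> NZero \<and> nf_content s = mset_set {..<n}}"

text \<open>
  Viewing a monomial as a nonempty word of pairs followed by a last element of \<open>W\<close> allows words to
  be concatenated, with no special treatment of the first pair.
\<close>

fun word_monom :: "(wbasis \<times> var) list \<Rightarrow> wbasis \<Rightarrow> monom" where
  "word_monom ((a, u) # s) b = Mon a u s b"
| "word_monom [] b = undefined"

lemma nf_word_monom: "ps \<noteq> [] \<Longrightarrow>
    nf (word_monom ps b) = step_w (foldl (\<lambda>t (k, v). step_v (step_w t k) v) (NDiag {#}) ps) b"
  by (cases ps) auto

lemma foldl_Y:
  "foldl (\<lambda>t (k, v). step_v (step_w t k) v) (NDiag M) (map (\<lambda>i. (W_one, Y i)) xs) = NDiag (M + mset xs)"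
  "foldl (\<lambda>t (k, v). step_v (step_w t k) v) (NUp M c N) (map (\<lambda>i. (W_one, Y i)) xs) = NUp M c (N + mset xs)"
  by (induction xs arbitrary: M N) auto

text \<open>
  Each nonzero normal form with at least one variable is reached by writing it out as a monomial.
  In \<open>y\<^sup>M e12 y\<^sup>N\<close> the factor \<open>e12\<close> sits in front of the first variable of \<open>y\<^sup>N\<close>, or at the right
  end if \<open>N\<close> is empty.
\<close>

lemma nf_realized:
  assumes "s \<noteq> NZero" "nf_content s \<noteq> {#}"
  obtains m where "nf m = s" "image_mset var_index (mset (monom_vars m)) = nf_content s"
proof -
  let ?y = "map (\<lambda>i. (W_one, Y i))"
  have "\<exists>ps b. ps \<noteq> [] \<and> step_w (foldl (\<lambda>t (k, v). step_v (step_w t k) v) (NDiag {#}) ps) b = s"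
  proof (cases s)
    case NZero
    with assms show ?thesis by simp
  next
    case (NDiag M)
    obtain xs where "mset xs = M" using ex_mset by blast
    with NDiag assms show ?thesis
      by (intro exI[of _ "?y xs"] exI[of _ W_one]) (auto simp: foldl_Y)
  next
    case (NLow M)
    obtain xs where "mset xs = M" using ex_mset by blast
    with NLow assms show ?thesis
      by (intro exI[of _ "?y xs"] exI[of _ W_e22]) (auto simp: foldl_Y)
  next
    case (NUp M c N)
    obtain xs xs' where xs: "mset xs = M" "mset xs' = N" using ex_mset by metis
    show ?thesis
    proof (cases c)
      case (Some k)
      with NUp xs show ?thesis
        by (intro exI[of _ "?y xs @ (W_one, Z k) # ?y xs'"] exI[of _ W_one]) (auto simp: foldl_Y)
    next
      case None
      show ?thesis
      proof (cases xs')
        case Nil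
        with None NUp xs assms show ?thesis
          by (intro exI[of _ "?y xs"] exI[of _ W_e12]) (auto simp: foldl_Y)
      next
        case (Cons x zs)
        with None NUp xs show ?thesis
          by (intro exI[of _ "?y xs @ (W_e12, Y x) # ?y zs"] exI[of _ W_one]) (auto simp: foldl_Y)
      qed
    qed
  qed
  then obtain ps b where "nf (word_monom ps b) = s" by (metis nf_word_monom)
  with assms(1) nf_content_nf[of "word_monom ps b"] show ?thesis
    by (intro that[of "word_monom ps b"]) auto
qed

lemma multilinear_nforms_eq:
  "multilinear_nforms n = {NDiag (mset_set {..<n}), NLow (mset_set {..<n})} \<union>
     (\<lambda>A. NUp (mset_set A) None (mset_set ({..<n} - A))) ` Pow {..<n} \<union>
     (\<lambda>(k, A). NUp (mset_set A) (Some k) (mset_set ({..<n} - {k} - A))) `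
       (SIGMA k:{..<n}. Pow ({..<n} - {k}))"
  (is "_ = ?D \<union> ?E ` _ \<union> ?F ` _")
proof -
  have split: "\<exists>A\<subseteq>I. M = mset_set A \<and> N = mset_set (I - A)"
    if "finite I" "M + N = mset_set I" for M N and I :: "nat set"
  proof -
    have "M \<subseteq># mset_set I" by (simp flip: that(2))
    then have le: "count M x \<le> (if x \<in> I then 1 else 0)" for x
      using mset_subset_eq_count[of M "mset_set I" x] that(1) by (simp add: count_mset_set')
    have M: "M = mset_set (set_mset M)"
    proof (rule multiset_eqI)
      fix x
      show "count M x = count (mset_set (set_mset M)) x"
        using le[of x] by (auto simp: count_mset_set' not_in_iff Suc_le_eq intro!: le_antisym split: if_splits)
    qed
    have I: "set_mset M \<subseteq> I"
      using le by (metis count_eq_zero_iff le_zero_eq subsetI)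
    have "N = mset_set I - M" by (simp flip: that(2))
    also have "\<dots> = mset_set (I - set_mset M)"
      using mset_set_Diff[OF that(1) I] M by simp
    finally show ?thesis using M I by blast
  qed
  have join: "mset_set A + mset_set (I - A) = mset_set I" if "finite I" "A \<subseteq> I"
    for A I :: "nat set"
    using that by (simp add: mset_set_Diff finite_subset subset_imp_msubset_mset_set)
  have "s \<in> ?D \<union> ?E ` Pow {..<n} \<union> ?F ` (SIGMA k:{..<n}. Pow ({..<n} - {k}))"
    if s: "s \<in> multilinear_nforms n" for s
  proof (cases s)
    case (NUp M c N)
    show ?thesis
    proof (cases c)
      case None
      then show ?thesis
        using s NUp split[of "{..<n}" M N] by (auto simp: multilinear_nforms_def)
    next
      case (Some k)
      then have *: "add_mset k (M + N) = mset_set {..<n}"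
        using s NUp by (simp add: multilinear_nforms_def)
      have "k \<in># mset_set {..<n}" by (simp flip: *)
      then have k: "k \<in> {..<n}" by simp
      have "M + N = mset_set {..<n} - {#k#}" by (simp flip: *)
      also have "\<dots> = mset_set ({..<n} - {k})"
        using k mset_set_Diff[of "{..<n}" "{k}"] by simp
      finally have "M + N = mset_set ({..<n} - {k})" .
      then obtain A where "A \<subseteq> {..<n} - {k}" "M = mset_set A" "N = mset_set ({..<n} - {k} - A)"
        using split[of "{..<n} - {k}" M N] by auto
      with k Some NUp show ?thesis by (auto intro!: image_eqI[of _ ?F "(k, A)"])
    qed
  qed (use s in \<open>auto simp: multilinear_nforms_def\<close>)
  moreover have "?F (k, A) \<in> multilinear_nforms n" if "k < n" "A \<subseteq> {..<n} - {k}" for k A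
  proof -
    have "nf_content (?F (k, A)) = add_mset k (mset_set ({..<n} - {k}))"
      using join[of "{..<n} - {k}" A] that(2) by simp
    also have "\<dots> = mset_set {..<n}"
      using that(1) by (simp flip: mset_set.insert_remove add: insert_absorb)
    finally show ?thesis by (simp add: multilinear_nforms_def)
  qed
  moreover have "?E A \<in> multilinear_nforms n" if "A \<subseteq> {..<n}" for A
    using that join[of "{..<n}" A] by (simp add: multilinear_nforms_def)
  moreover have "?D \<subseteq> multilinear_nforms n"
    by (simp add: multilinear_nforms_def)
  ultimately show ?thesis by auto
qed

text \<open>
  There are 2 forms without \<open>e12\<close> and \<open>z\<close>, \<open>2\<^sup>n\<close> forms with \<open>e12\<close> (a subset of the \<open>n\<close> variables to the left of
  it), and \<open>n\<close> choices of \<open>z\<close> with \<open>2\<close> to the \<open>n - 1\<close> subsets of the remaining variables each.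
\<close>

lemma card_multilinear_nforms:
  assumes "n \<ge> 1"
  shows "finite (multilinear_nforms n)" "card (multilinear_nforms n) = 2 ^ (n - 1) * (n + 2) + 2"
proof -
  let ?I = "{..<n}"
  let ?D = "{NDiag (mset_set ?I), NLow (mset_set ?I)}"
  let ?E = "(\<lambda>A. NUp (mset_set A) None (mset_set (?I - A))) ` Pow ?I"
  let ?F = "(\<lambda>(k, A). NUp (mset_set A) (Some k) (mset_set (?I - {k} - A))) `
    (SIGMA k:?I. Pow (?I - {k}))"
  have inj: "mset_set A = mset_set B \<longleftrightarrow> A = B" if "finite A" "finite B" for A B :: "nat set"
    using that by (metis finite_set_mset_mset_set)
  have sub: "finite A" if "A \<subseteq> ?I" for A using that by (rule finite_subset) simp
  have "card ?E = 2 ^ n"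
    by (subst card_image) (auto simp: inj_on_def inj sub card_Pow)
  moreover have "card ?F = n * 2 ^ (n - 1)"
  proof (subst card_image)
    show "inj_on (\<lambda>(k, A). NUp (mset_set A) (Some k) (mset_set (?I - {k} - A)))
        (SIGMA k:?I. Pow (?I - {k}))"
      by (auto simp: inj_on_def inj sub)
  qed (simp add: card_SigmaI card_Pow)
  moreover have "card (?D \<union> ?E \<union> ?F) = card ?D + card ?E + card ?F"
  proof -
    have fin: "finite ?E" "finite ?F" by (auto intro!: finite_imageI finite_SigmaI)
    have disj: "?D \<inter> ?E = {}" "(?D \<union> ?E) \<inter> ?F = {}" by auto
    have "card (?D \<union> ?E \<union> ?F) = card (?D \<union> ?E) + card ?F"
      by (rule card_Un_disjoint[OF _ fin(2) disj(2)]) (simp add: fin)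
    also have "card (?D \<union> ?E) = card ?D + card ?E"
      by (rule card_Un_disjoint[OF _ fin(1) disj(1)]) simp
    finally show ?thesis .
  qed
  moreover have "(2::nat) ^ n = 2 * 2 ^ (n - 1)"
    using assms by (cases n) simp_all
  ultimately show "card (multilinear_nforms n) = 2 ^ (n - 1) * (n + 2) + 2"
    unfolding multilinear_nforms_eq by (simp add: algebra_simps)
  show "finite (multilinear_nforms n)"
    unfolding multilinear_nforms_eq by (intro finite_UnI finite_imageI finite_SigmaI) auto
qed

lemma keys_span:
  assumes "f \<in> free.span (fmono ` B)"
  shows "Poly_Mapping.keys f \<subseteq> B"
  using assms
proof (induction rule: free.span_induct)
  case base
  show ?case
  proof (rule free.subspaceI)
    show "0 \<in> {f :: 'a free_walg. Poly_Mapping.keys f \<subseteq> B}" by simp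
    show "f + g \<in> {f. Poly_Mapping.keys f \<subseteq> B}"
      if "f \<in> {f. Poly_Mapping.keys f \<subseteq> B}" "g \<in> {f. Poly_Mapping.keys f \<subseteq> B}"
      for f g :: "'a free_walg"
      using that keys_add[of f g] by blast
    show "fscale c f \<in> {f. Poly_Mapping.keys f \<subseteq> B}"
      if "f \<in> {f. Poly_Mapping.keys f \<subseteq> B}" for c and f :: "'a free_walg"
      using that by (auto simp: in_keys_iff lookup_fscale)
  qed
qed (auto simp: fmono_def)

text \<open>
  The multilinear normal forms are a basis of the multilinear space modulo the identities. They span
  because subtracting the normal forms with the coefficients \<open>nf_coeff s v\<close> leaves an element all of
  whose coefficients vanish, that is, an identity.
\<close>

theorem codimension_Id_UT2:
  assumes "n \<ge> 1"
  shows "codimension (Id_UT2 :: 'f::field_char_0 free_walg set) n = 2 ^ (n - 1) * (n + 2) + 2"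
proof -
  let ?V = "multilinear_space n :: 'f free_walg set" and ?S = "multilinear_nforms n"
  have "\<exists>m. m \<in> multilinear_monoms n \<and> nf m = s" if "s \<in> ?S" for s
  proof -
    from that have s: "s \<noteq> NZero" "nf_content s = mset_set {..<n}"
      by (auto simp: multilinear_nforms_def)
    moreover have "mset_set {..<n} \<noteq> {#}" using assms by (simp add: mset_set_empty_iff lessThan_empty_iff)
    ultimately obtain m where "nf m = s" "image_mset var_index (mset (monom_vars m)) = nf_content s"
      using nf_realized by metis
    with s show ?thesis by (auto simp: multilinear_monoms_iff[OF assms])
  qed
  then obtain r where r: "\<And>s. s \<in> ?S \<Longrightarrow> r s \<in> multilinear_monoms n" "\<And>s. s \<in> ?S \<Longrightarrow> nf (r s) = s"
    by metis
  have coeff: "nf_coeff t (\<Sum>s\<in>?S. fscale (c s) (fmono (r s) :: 'f free_walg)) =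
      (if t \<in> ?S then c t else 0)" for c t
  proof -
    have "nf_coeff t (\<Sum>s\<in>?S. fscale (c s) (fmono (r s))) = (\<Sum>s\<in>?S. if s = t then c s else 0)"
      unfolding nf_coeff_sum by (rule sum.cong) (auto simp: nf_coeff_scale nf_coeff_fmono r(2))
    then show ?thesis using card_multilinear_nforms(1)[OF assms] by simp
  qed
  have "codimension (Id_UT2 :: 'f free_walg set) n = card ?S"
    unfolding codimension_def
  proof (rule dim_quotient_space[where r = "\<lambda>s. fmono (r s)"])
    show "vector_space (fscale :: 'f \<Rightarrow> _)" by unfold_locales
    show "free.subspace ?V" by (simp add: multilinear_space_def)
    then show "free.subspace (?V \<inter> Id_UT2)"
      using TW_ideal_Id_UT2 by (auto simp: TW_ideal_def intro: free.subspace_inter)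
    show "(\<lambda>s. fmono (r s)) ` ?S \<subseteq> ?V"
      using r(1) by (auto simp: multilinear_space_def intro: free.span_base)
    then have rV: "(\<Sum>s\<in>?S. fscale (c s) (fmono (r s))) \<in> ?V" for c
      unfolding multilinear_space_def by (intro free.span_sum free.span_scale) auto
    show "c s = 0" if "(\<Sum>s\<in>?S. fscale (c s) (fmono (r s))) \<in> ?V \<inter> Id_UT2" "s \<in> ?S" for c s
    proof -
      have "s \<noteq> NZero" using that(2) by (simp add: multilinear_nforms_def)
      with that coeff[of s c] show ?thesis by (simp add: mem_Id_UT2_iff)
    qed
    show "\<exists>c. v - (\<Sum>s\<in>?S. fscale (c s) (fmono (r s))) \<in> ?V \<inter> Id_UT2" if v: "v \<in> ?V" for v
    proof (intro exI[of _ "\<lambda>s. nf_coeff s v"] IntI)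
      let ?w = "\<Sum>s\<in>?S. fscale (nf_coeff s v) (fmono (r s))"
      show "v - ?w \<in> ?V"
        using v rV[of "\<lambda>s. nf_coeff s v"] unfolding multilinear_space_def by (rule free.span_diff)
      have "nf_coeff t v = 0" if t: "t \<noteq> NZero" "t \<notin> ?S" for t
      proof -
        have "Poly_Mapping.keys v \<subseteq> multilinear_monoms n"
          using v unfolding multilinear_space_def by (rule keys_span)
        then have "nf m \<noteq> t" if "m \<in> Poly_Mapping.keys v" for m
          using that t nf_content_nf[of m]
          by (auto simp: multilinear_nforms_def multilinear_monoms_iff[OF assms])
        then show ?thesis by (simp add: nf_coeff_def)
      qed
      then show "v - ?w \<in> Id_UT2"
        unfolding mem_Id_UT2_iff nf_coeff_diff coeff by simp
    qed
  qed (simp_all add: card_multilinear_nforms(1)[OF assms])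
  with card_multilinear_nforms(2)[OF assms] show ?thesis by simp
qed


theorem theorem5p2:
  "(Id_UT2 :: 'f::field_char_0 free_walg set) =
     TW_ideal_gen
       {fcomm (fvar (Y 0)) (fvar (Y 1)),
        lact e22 (fvar (Y 0)) - ract (fvar (Y 0)) e22,
        ract (fvar (Z 0)) e22 - fvar (Z 0),
        lact e22 (fvar (Z 0))} \<and>
   (\<forall>n\<ge>1. codimension (Id_UT2 :: 'f free_walg set) n = 2 ^ (n - 1) * (n + 2) + 2)"
  using Id_UT2_generated codimension_Id_UT2 by blast

end
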